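(* Consider the following relations on $\mathbb Z$, all first-order definable in $\langle \mathbb Z,<\rangle$: \begin{itemize} \item $x<y$ (order); \item $+1$: the binary successor relation $y=x+1$; \item ${A_1}_1(x,y,z,t)\iff (x-y=z-t)\wedge |x-y|=1$ (1-codirection); \item $B(a,b,c)\iff (a<b<c)\vee(a>b>c)$ (between); \item $C(a,b,c)\iff (a<b<c)\vee(b<c<a)\vee(c<a<b)$ (cycle); \item $S(a,b,c,d)\iff \big(B(a,b,c)\vee B(a,d,c)\big)\wedge\big(B(b,a,d)\vee B(b,c,d)\big)$ (separation). \end{itemize} For a relation $R$ on $\mathbb Z$ let $\langle R\rangle$ denote the definability space generated by $R$. Then: \begin{enumerate} \item The definability spaces $V$ on $\mathbb Z$ with $\langle {A_1}_1\rangle\subseteq V\subseteq\langle <\rangle$ are exactly the six spaces $\langle {A_1}_1\rangle,\ \langle +1\rangle,\ \langle S\rangle,\ \langle B\rangle,\ \langle C\rangle,\ \langle <\rangle$, and these six spaces are pairwise distinct. \item The following inclusions hold and are all strict: \[\langle {A_1}_1\rangle\subsetneq\langle +1\rangle,\quad \langle {A_1}_1\rangle\subsetneq\langle S\rangle,\quad \langle S\rangle\subsetneq\langle B\rangle,\quad \langle S\rangle\subsetneq\langle C\rangle,\quad \langle +1\rangle\subsetneq\langle C\rangle,\quad \langle B\rangle\subsetneq\langle <\rangle,\quad \langle C\rangle\subsetneq\langle <\rangle.\] \item Every inclusion between two of these six spaces follows from the inclusions listed in (2) by transitivity. In particular, $\langle +1\rangle$ and $\langle S\rangle$ are incomparable,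 $\langle +1\rangle$ and $\langle B\rangle$ are incomparable, and $\langle B\rangle$ and $\langle C\rangle$ are incomparable. \end{enumerate}
   Context: A definability space on a set $U$ is a set of relations on $U$ (of all finite arities) that is closed under first-order definability: every relation that is first-order definable without parameters (with equality allowed) from relations in the set belongs to the set. For a relation $R$ on $U$, $\langle R\rangle$ is the set of all relations on $U$ first-order definable (with equality, without parameters) from $R$. All relations above are definable in $\langle\mathbb Z,<\rangle$, so all these spaces lie inside $\langle <\rangle$. *)

theory Defs
  imports Main
begin

text \<open>A relation on the integers: its arity together with the set of tuples (as lists).\<close>
type_synonym zrel = "nat \<times> int list set"

definition wf_rel :: "zrel \<Rightarrow> bool" where
  "wf_rel r \<longleftrightarrow> (\<forall>xs \<in> snd r. length xs = fst r)"

datatype fm = Eq nat nat | Atom zrel "nat list" | Neg fm | Conj fm fm | Ex nat fm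

fun sat :: "(nat \<Rightarrow> int) \<Rightarrow> fm \<Rightarrow> bool" where
  "sat e (Eq i j) = (e i = e j)"
| "sat e (Atom R vs) = (map e vs \<in> snd R)"
| "sat e (Neg f) = (\<not> sat e f)"
| "sat e (Conj f g) = (sat e f \<and> sat e g)"
| "sat e (Ex x f) = (\<exists>a. sat (e(x := a)) f)"

fun fv :: "fm \<Rightarrow> nat set" where
  "fv (Eq i j) = {i, j}"
| "fv (Atom R vs) = set vs"
| "fv (Neg f) = fv f"
| "fv (Conj f g) = fv f \<union> fv g"
| "fv (Ex x f) = fv f - {x}"

fun atoms :: "fm \<Rightarrow> (zrel \<times> nat list) set" where
  "atoms (Eq i j) = {}"
| "atoms (Atom R vs) = {(R, vs)}"
| "atoms (Neg f) = atoms f"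
| "atoms (Conj f g) = atoms f \<union> atoms g"
| "atoms (Ex x f) = atoms f"

definition definable :: "zrel set \<Rightarrow> zrel \<Rightarrow> bool" where
  "definable G r \<longleftrightarrow>
     (\<exists>\<phi>. (\<forall>(Q, vs) \<in> atoms \<phi>. Q \<in> G \<and> length vs = fst Q)
        \<and> fv \<phi> \<subseteq> {..<fst r}
        \<and> snd r = {xs. length xs = fst r \<and> sat (\<lambda>i. xs ! i) \<phi>})"

definition dspace :: "zrel set \<Rightarrow> bool" where
  "dspace V \<longleftrightarrow> (\<forall>r \<in> V. wf_rel r) \<and> (\<forall>r. definable V r \<longrightarrow> r \<in> V)"

definition span :: "zrel \<Rightarrow> zrel set" where
  "span R = {r. definable {R} r}"

definition lt_rel :: zrel where
  "lt_rel = (2, {[x, y] | x y. x < y})"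

definition succ_rel :: zrel where
  "succ_rel = (2, {[x, y] | x y. y = x + 1})"

definition A11_rel :: zrel where
  "A11_rel = (4, {[x, y, z, t] | x y z t. x - y = z - t \<and> \<bar>x - y\<bar> = 1})"

definition betw :: "int \<Rightarrow> int \<Rightarrow> int \<Rightarrow> bool" where
  "betw a b c \<longleftrightarrow> (a < b \<and> b < c) \<or> (a > b \<and> b > c)"

definition B_rel :: zrel where
  "B_rel = (3, {[a, b, c] | a b c. betw a b c})"

definition C_rel :: zrel where
  "C_rel = (3, {[a, b, c] | a b c. (a < b \<and> b < c) \<or> (b < c \<and> c < a) \<or> (c < a \<and> a < b)})"

definition S_rel :: zrel where
  "S_rel = (4, {[a, b, c, d] | a b c d.
              (betw a b c \<or> betw a d c) \<and> (betw b a d \<or> betw b c d)})"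

text \<open>The six spaces, indexed 0..5, and the Hasse edges of part (2).\<close>
definition six :: "zrel set list" where
  "six = [span A11_rel, span succ_rel, span S_rel, span B_rel, span C_rel, span lt_rel]"

definition hasse :: "(nat \<times> nat) set" where
  "hasse = {(0,1), (0,2), (2,3), (2,4), (1,4), (3,5), (4,5)}"

end

theory Submission
  imports Defs
begin

text \<open>
  Every relation first-order definable in \<open>(\<int>, <)\<close> only depends on differences of coordinates truncated
  at some \<open>N\<close>, i.e. on the shape and the order of far apart clusters. Let \<open>V\<close> contain the successor.
  If some relation of \<open>V\<close> changes its truth value when the clusters are rotated cyclically, a single
  instance of this defines \<open><\<close>; otherwise all of \<open>V\<close> is definable from the cyclic order. If moreover some
  relation is not invariant under arbitrary permutations of the clusters, it distinguishes two
  neighbouring clusters up to rotation, which defines the cyclic order; otherwise all of \<open>V\<close> is definable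
  from the successor. If \<open>V\<close> is only known to contain the codirection, either some relation of \<open>V\<close> is not invariant
  under \<open>x \<mapsto> - x\<close>, and then orienting it along an edge defines the successor, or \<open>V\<close> is exactly the
  reflection invariant part of the space generated by \<open>V\<close> and the successor.
\<close>

section \<open>Formulas and definability spaces\<close>

text \<open>The usual automorphism argument in a saturated extension is replaced by explicit bounds.
  For \<open><\<close>, \<open>+1\<close> and \<open>C\<close> there is an equivalence of
  assignments with a parameter \<open>N\<close>: distances up to \<open>N\<close> count exactly,
  larger ones as infinite. Removing a quantifier raises \<open>N\<close> to
  \<open>2 * N + 1\<close>: a witness within \<open>N\<close> of two points puts them within
  \<open>2 * N\<close> of each other, and a witness lying between two points and far from both needs
  a gap of \<open>2 * N + 2\<close>. The integers have no infinitely distant points, so clusters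
  exist only relative to a scale, and this scale must be bounded by \<open>N\<close> and the arity
  before the tuple is known; a pigeonhole argument over doubling scales provides it. One failure of
  invariance defines an order because \<open>+1\<close> already settles every configuration with a
  short distance. Only widely spread configurations are left, and the failing instance tells these
  apart. Spaces without \<open>+1\<close> are recovered from the larger space that \<open>+1\<close>
  generates with them, so their classification is inherited.\<close>

definition over :: "zrel set \<Rightarrow> fm \<Rightarrow> bool" where
  "over V \<phi> \<longleftrightarrow> (\<forall>(Q, vs) \<in> atoms \<phi>. Q \<in> V \<and> length vs = fst Q)"

lemma over_simps [simp]:
  "over V (Eq i j)"
  "over V (Atom Q vs) \<longleftrightarrow> Q \<in> V \<and> length vs = fst Q"
  "over V (Neg f) \<longleftrightarrow> over V f"
  "over V (Conj f g) \<longleftrightarrow> over V f \<and> over V g"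
  "over V (Ex x f) \<longleftrightarrow> over V f"
  by (auto simp: over_def)

lemma finite_fv [simp]: "finite (fv \<phi>)"
  by (induction \<phi>) auto

lemma sat_cong: "(\<And>i. i \<in> fv \<phi> \<Longrightarrow> e i = e' i) \<Longrightarrow> sat e \<phi> = sat e' \<phi>"
proof (induction \<phi> arbitrary: e e')
  case (Atom Q vs)
  then have "map e vs = map e' vs" by simp
  then show ?case by (simp only: sat.simps)
next
  case (Conj f g)
  then show ?case by (metis UnCI fv.simps(4) sat.simps(4))
next
  case (Ex x f)
  have "sat (e(x := a)) f = sat (e'(x := a)) f" for a
    by (rule Ex.IH) (use Ex.prems in auto)
  then show ?case by (simp only: sat.simps)
next
  case (Neg f)
  then show ?case unfolding sat.simps fv.simps by blast
next
  case (Eq i j)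
  then show ?case by simp
qed

text \<open>The map \<open>f\<close> may identify variables, since an atom may repeat arguments.
  Existence of some \<open>\<psi>\<close> is claimed instead of fixing a substitution function, so
  bound variables can be chosen anew at each quantifier.\<close>

lemma rename_exists:
  "over V \<phi> \<Longrightarrow> \<exists>\<psi>. over V \<psi> \<and> fv \<psi> \<subseteq> f ` fv \<phi> \<and> (\<forall>e. sat e \<psi> = sat (\<lambda>i. e (f i)) \<phi>)"
proof (induction \<phi> arbitrary: f)
  case (Eq i j)
  show ?case by (rule exI[of _ "Eq (f i) (f j)"]) auto
next
  case (Atom Q vs)
  have "map e (map f vs) = map (\<lambda>i. e (f i)) vs" for e :: "nat \<Rightarrow> int"
    by simp
  then have "sat e (Atom Q (map f vs)) = sat (\<lambda>i. e (f i)) (Atom Q vs)" for e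
    unfolding sat.simps by (rule arg_cong)
  with Atom show ?case
    by (intro exI[of _ "Atom Q (map f vs)"]) (simp del: sat.simps)
next
  case (Neg \<phi>)
  then have "over V \<phi>" by simp
  from Neg.IH[OF this, of f] obtain \<psi>
    where "over V \<psi>" "fv \<psi> \<subseteq> f ` fv \<phi>" "\<forall>e. sat e \<psi> = sat (\<lambda>i. e (f i)) \<phi>"
    by blast
  then show ?case by (intro exI[of _ "Neg \<psi>"]) auto
next
  case (Conj \<phi>1 \<phi>2)
  from Conj.prems have "over V \<phi>1" "over V \<phi>2" by auto
  then obtain \<psi>1 \<psi>2 where
    "over V \<psi>1" "fv \<psi>1 \<subseteq> f ` fv \<phi>1" "\<forall>e. sat e \<psi>1 = sat (\<lambda>i. e (f i)) \<phi>1"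
    "over V \<psi>2" "fv \<psi>2 \<subseteq> f ` fv \<phi>2" "\<forall>e. sat e \<psi>2 = sat (\<lambda>i. e (f i)) \<phi>2"
    using Conj.IH[of f] by blast
  then show ?case by (intro exI[of _ "Conj \<psi>1 \<psi>2"]) auto
next
  case (Ex x \<phi>)
  \<comment> \<open>Freshness of \<open>y\<close> prevents capture: no free variable of
    \<open>\<phi>\<close> other than \<open>x\<close> is sent to \<open>y\<close>.\<close>
  obtain y where y: "y \<notin> f ` fv \<phi>"
    by (meson ex_new_if_finite finite_fv finite_imageI infinite_UNIV_nat)
  from Ex.prems have "over V \<phi>" by simp
  from Ex.IH[OF this, of "f(x := y)"] obtain \<psi> where
    \<psi>: "over V \<psi>" "fv \<psi> \<subseteq> (f(x := y)) ` fv \<phi>"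
       "\<forall>e. sat e \<psi> = sat (\<lambda>i. e ((f(x := y)) i)) \<phi>"
    by blast
  have "sat (e(y := a)) \<psi> = sat ((\<lambda>i. e (f i))(x := a)) \<phi>" for e a
  proof -
    have "sat (\<lambda>i. (e(y := a)) ((f(x := y)) i)) \<phi> = sat ((\<lambda>i. e (f i))(x := a)) \<phi>"
    proof (rule sat_cong)
      fix i assume "i \<in> fv \<phi>"
      with y have "f i \<noteq> y" by blast
      then show "(e(y := a)) ((f(x := y)) i) = ((\<lambda>i. e (f i))(x := a)) i" by simp
    qed
    then show ?thesis using \<psi>(3) by blast
  qed
  then have "sat e (Ex y \<psi>) = sat (\<lambda>i. e (f i)) (Ex x \<phi>)" for e
    by (simp only: sat.simps)
  moreover have "fv (Ex y \<psi>) \<subseteq> f ` fv (Ex x \<phi>)"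
    using \<psi>(2) by (auto split: if_splits)
  ultimately show ?case using \<psi>(1) by (intro exI[of _ "Ex y \<psi>"]) (simp del: sat.simps)
qed

text \<open>Definability of a HOL predicate on total assignments; the arity survives only as a bound
  on the free variables. Later proofs combine predicates and rarely touch formulas.\<close>

definition fdef :: "zrel set \<Rightarrow> nat \<Rightarrow> ((nat \<Rightarrow> int) \<Rightarrow> bool) \<Rightarrow> bool" where
  "fdef V n P \<longleftrightarrow> (\<exists>\<phi>. over V \<phi> \<and> fv \<phi> \<subseteq> {..<n} \<and> (\<forall>e. sat e \<phi> = P e))"

definition holds :: "zrel \<Rightarrow> (nat \<Rightarrow> int) \<Rightarrow> bool" where
  "holds r e \<longleftrightarrow> map e [0..<fst r] \<in> snd r"

lemma definable_iff: "definable V r \<longleftrightarrow> wf_rel r \<and> fdef V (fst r) (holds r)"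
proof
  assume "definable V r"
  then obtain \<phi> where \<phi>: "over V \<phi>" "fv \<phi> \<subseteq> {..<fst r}"
      "snd r = {xs. length xs = fst r \<and> sat (\<lambda>i. xs ! i) \<phi>}"
    by (auto simp: definable_def over_def)
  have "sat (\<lambda>i. map e [0..<fst r] ! i) \<phi> = sat e \<phi>" for e
    by (rule sat_cong) (use \<phi>(2) in auto)
  then have "sat e \<phi> = holds r e" for e
    by (simp add: \<phi>(3) holds_def)
  with \<phi> show "wf_rel r \<and> fdef V (fst r) (holds r)"
    unfolding wf_rel_def fdef_def by blast
next
  assume r: "wf_rel r \<and> fdef V (fst r) (holds r)"
  then obtain \<phi> where \<phi>: "over V \<phi>" "fv \<phi> \<subseteq> {..<fst r}" "\<forall>e. sat e \<phi> = holds r e"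
    by (auto simp: fdef_def)
  have "xs \<in> snd r \<longleftrightarrow> length xs = fst r \<and> sat (\<lambda>i. xs ! i) \<phi>" for xs
  proof (cases "length xs = fst r")
    case True
    then have "map (\<lambda>i. xs ! i) [0..<fst r] = xs" by (metis map_nth)
    with \<phi>(3) True show ?thesis by (simp add: holds_def)
  next
    case False
    with r show ?thesis by (auto simp: wf_rel_def)
  qed
  with \<phi> show "definable V r"
    unfolding definable_def over_def by blast
qed

lemma fdef_not: "fdef V n P \<Longrightarrow> fdef V n (\<lambda>e. \<not> P e)"
  unfolding fdef_def by (metis fv.simps(3) over_simps(3) sat.simps(3))

lemma fdef_conj:
  assumes "fdef V n P" "fdef V n Q" shows "fdef V n (\<lambda>e. P e \<and> Q e)"
proof -
  obtain \<phi> \<psi> where "over V \<phi>" "fv \<phi> \<subseteq> {..<n}" "\<forall>e. sat e \<phi> = P e"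
    "over V \<psi>" "fv \<psi> \<subseteq> {..<n}" "\<forall>e. sat e \<psi> = Q e"
    using assms unfolding fdef_def by blast
  then show ?thesis unfolding fdef_def by (intro exI[of _ "Conj \<phi> \<psi>"]) auto
qed

lemma fdef_disj:
  assumes "fdef V n P" "fdef V n Q" shows "fdef V n (\<lambda>e. P e \<or> Q e)"
  using fdef_not[OF fdef_conj[OF assms[THEN fdef_not]]] by simp

lemma fdef_ex:
  assumes "fdef V (Suc n) P" shows "fdef V n (\<lambda>e. \<exists>a. P (e(n := a)))"
proof -
  obtain \<phi> where "over V \<phi>" "fv \<phi> \<subseteq> {..<Suc n}" "\<forall>e. sat e \<phi> = P e"
    using assms unfolding fdef_def by blast
  then show ?thesis unfolding fdef_def by (intro exI[of _ "Ex n \<phi>"]) fastforce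
qed

lemma fdef_eq: "i < n \<Longrightarrow> j < n \<Longrightarrow> fdef V n (\<lambda>e. e i = e j)"
  unfolding fdef_def by (rule exI[of _ "Eq i j"]) auto

lemma fdef_atom:
  "r \<in> V \<Longrightarrow> length vs = fst r \<Longrightarrow> set vs \<subseteq> {..<n} \<Longrightarrow> fdef V n (\<lambda>e. map e vs \<in> snd r)"
  unfolding fdef_def by (rule exI[of _ "Atom r vs"]) simp

lemma fdef_const: "fdef V n (\<lambda>e. b)"
proof -
  have "fdef V n (\<lambda>e. True)"
    \<comment> \<open>A closed true formula, so that \<open>n = 0\<close> is covered.\<close>
    unfolding fdef_def by (rule exI[of _ "Ex 0 (Eq 0 0)"]) auto
  with fdef_not[OF this] show ?thesis by (cases b) simp_all
qed

text \<open>A predicate that factors through finitely many definable tests is a Boolean combination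
  of them; the induction splits on the value of one test.\<close>

lemma fdef_finite_tests:
  assumes "finite F" "\<And>P. P \<in> F \<Longrightarrow> fdef V n P"
    and "\<And>e e'. \<forall>P\<in>F. P e = P e' \<Longrightarrow> X e = X e'"
  shows "fdef V n X"
  using assms
proof (induction F arbitrary: X rule: finite_induct)
  case empty
  then have "X = (\<lambda>e. X undefined)" by blast
  then show ?case by (metis fdef_const)
next
  case (insert P F)
  \<comment> \<open>The existential over \<open>e'\<close> makes \<open>Y b\<close> a function of
    the tests in \<open>F\<close> alone, although \<open>X\<close> may still depend on
    \<open>P\<close>.\<close>
  define Y where "Y b e \<longleftrightarrow> (\<exists>e'. P e' = b \<and> (\<forall>Q\<in>F. Q e = Q e') \<and> X e')" for b e
  have Y: "fdef V n (Y b)" for b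
  proof (rule insert.IH)
    show "fdef V n Q" if "Q \<in> F" for Q using insert.prems(1) that by blast
    show "Y b e = Y b e'" if "\<forall>Q\<in>F. Q e = Q e'" for e e'
    proof -
      have "(\<forall>Q\<in>F. Q e = Q d) \<longleftrightarrow> (\<forall>Q\<in>F. Q e' = Q d)" for d
        by (rule ball_cong[OF refl]) (simp add: that)
      then show ?thesis unfolding Y_def by presburger
    qed
  qed
  have X: "X e \<longleftrightarrow> P e \<and> Y True e \<or> \<not> P e \<and> Y False e" for e
  proof
    assume "X e"
    then show "P e \<and> Y True e \<or> \<not> P e \<and> Y False e" unfolding Y_def by blast
  next
    assume "P e \<and> Y True e \<or> \<not> P e \<and> Y False e"
    then obtain e' where "P e' = P e" "\<forall>Q\<in>F. Q e = Q e'" "X e'"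
      unfolding Y_def by (metis (full_types))
    then show "X e" using insert.prems(2)[of e e'] by blast
  qed
  have P: "fdef V n P" by (simp add: insert.prems(1))
  have "X = (\<lambda>e. P e \<and> Y True e \<or> \<not> P e \<and> Y False e)" using X by blast
  then show ?case
    using fdef_disj[OF fdef_conj[OF P Y[of True]] fdef_conj[OF fdef_not[OF P] Y[of False]]]
    by simp
qed

lemma subst_definable:
  assumes "\<And>Q. Q \<in> W \<Longrightarrow> definable V Q"
  shows "over W \<phi> \<Longrightarrow> \<exists>\<psi>. over V \<psi> \<and> fv \<psi> \<subseteq> fv \<phi> \<and> (\<forall>e. sat e \<psi> = sat e \<phi>)"
proof (induction \<phi>)
  case (Eq i j)
  show ?case by (rule exI[of _ "Eq i j"]) auto
next
  case (Atom Q vs)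
  then have Q: "Q \<in> W" and len: "length vs = fst Q" by auto
  from assms[OF Q] obtain \<phi> where \<phi>: "over V \<phi>" "fv \<phi> \<subseteq> {..<fst Q}" "\<forall>e. sat e \<phi> = holds Q e"
    by (auto simp: definable_iff fdef_def)
  obtain \<psi> where \<psi>: "over V \<psi>" "fv \<psi> \<subseteq> (!) vs ` fv \<phi>" "\<forall>e. sat e \<psi> = sat (\<lambda>i. e (vs ! i)) \<phi>"
    using rename_exists[OF \<phi>(1)] by blast
  have "fv \<psi> \<subseteq> set vs" using \<psi>(2) \<phi>(2) len by force
  moreover have "sat e \<psi> = sat e (Atom Q vs)" for e
  proof -
    have m: "map (\<lambda>i. e (vs ! i)) [0..<fst Q] = map e vs"
      by (rule nth_equalityI) (simp_all add: len)
    have h: "sat e \<psi> = holds Q (\<lambda>i. e (vs ! i))"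
      using \<psi>(3) \<phi>(3) by blast
    show ?thesis by (simp only: h holds_def m sat.simps)
  qed
  ultimately show ?case using \<psi>(1) by (intro exI[of _ \<psi>]) (simp del: sat.simps)
next
  case (Neg \<phi>)
  then have "over W \<phi>" by simp
  from Neg.IH[OF this] obtain \<psi> where "over V \<psi>" "fv \<psi> \<subseteq> fv \<phi>" "\<forall>e. sat e \<psi> = sat e \<phi>"
    by blast
  then show ?case by (intro exI[of _ "Neg \<psi>"]) auto
next
  case (Conj \<phi>1 \<phi>2)
  then have "over W \<phi>1" "over W \<phi>2" by simp_all
  then obtain \<psi>1 \<psi>2 where
    "over V \<psi>1" "fv \<psi>1 \<subseteq> fv \<phi>1" "\<forall>e. sat e \<psi>1 = sat e \<phi>1"
    "over V \<psi>2" "fv \<psi>2 \<subseteq> fv \<phi>2" "\<forall>e. sat e \<psi>2 = sat e \<phi>2"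
    using Conj.IH by blast
  then show ?case by (intro exI[of _ "Conj \<psi>1 \<psi>2"]) auto
next
  case (Ex x \<phi>)
  then have "over W \<phi>" by simp
  from Ex.IH[OF this] obtain \<psi> where "over V \<psi>" "fv \<psi> \<subseteq> fv \<phi>" "\<forall>e. sat e \<psi> = sat e \<phi>"
    by blast
  then show ?case by (intro exI[of _ "Ex x \<psi>"]) auto
qed

lemma definable_trans:
  assumes "\<And>Q. Q \<in> W \<Longrightarrow> definable V Q" "definable W r"
  shows "definable V r"
proof -
  obtain \<phi> where "over W \<phi>" "fv \<phi> \<subseteq> {..<fst r}" "\<forall>e. sat e \<phi> = holds r e" and wf: "wf_rel r"
    using assms(2) by (auto simp: definable_iff fdef_def)
  moreover from this obtain \<psi> where "over V \<psi>" "fv \<psi> \<subseteq> fv \<phi>" "\<forall>e. sat e \<psi> = sat e \<phi>"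
    using subst_definable[of W V \<phi>] assms(1) by blast
  ultimately show ?thesis
    unfolding definable_iff fdef_def by (intro conjI exI[of _ \<psi>]) auto
qed

definition gen :: "zrel set \<Rightarrow> zrel set" where
  "gen V = {r. definable V r}"

lemma span_eq_gen: "span R = gen {R}"
  by (simp add: span_def gen_def)

lemma definable_self:
  assumes "wf_rel r" "r \<in> V" shows "definable V r"
proof -
  have "holds r = (\<lambda>e. map e [0..<fst r] \<in> snd r)"
    by (simp add: holds_def fun_eq_iff)
  moreover have "fdef V (fst r) (\<lambda>e. map e [0..<fst r] \<in> snd r)"
    by (rule fdef_atom) (use assms in auto)
  ultimately show ?thesis using assms by (simp add: definable_iff)
qed

lemma dspace_gen: "dspace (gen V)"
  unfolding dspace_def
proof (intro conjI ballI allI impI)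
  show "wf_rel r" if "r \<in> gen V" for r
    using that by (simp add: gen_def definable_iff)
  show "r \<in> gen V" if "definable (gen V) r" for r
    using definable_trans[OF _ that, of V] by (simp add: gen_def)
qed

lemma dspace_closed: "dspace V \<Longrightarrow> definable V r \<Longrightarrow> r \<in> V"
  unfolding dspace_def by blast

lemma gen_least:
  assumes "dspace V" "W \<subseteq> V" shows "gen W \<subseteq> V"
proof
  fix r assume "r \<in> gen W"
  then have "definable V r"
    unfolding gen_def using assms definable_trans[of W V r] definable_self
    by (metis dspace_def mem_Collect_eq subsetD)
  with assms show "r \<in> V" by (simp add: dspace_closed)
qed

lemma dspace_span: "dspace (span R)"
  by (simp add: span_eq_gen dspace_gen)

lemma span_least: "dspace V \<Longrightarrow> R \<in> V \<Longrightarrow> span R \<subseteq> V"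
  by (simp add: span_eq_gen gen_least)

lemma in_span: "wf_rel R \<Longrightarrow> R \<in> span R"
  by (simp add: span_def definable_self)

lemma wf_in_dspace: "dspace V \<Longrightarrow> r \<in> V \<Longrightarrow> wf_rel r"
  by (simp add: dspace_def)

lemma fdef_in_dspace:
  assumes "dspace V" "wf_rel r" "fdef V (fst r) (holds r)" shows "r \<in> V"
  using assms by (simp add: dspace_closed definable_iff)

section \<open>Back-and-forth systems\<close>

type_synonym eqv = "int \<Rightarrow> nat set \<Rightarrow> (nat \<Rightarrow> int) \<Rightarrow> (nat \<Rightarrow> int) \<Rightarrow> bool"

definition invariant :: "eqv \<Rightarrow> int \<Rightarrow> zrel \<Rightarrow> bool" where
  "invariant E N r \<longleftrightarrow> (\<forall>e e'. E N {..<fst r} e e' \<longrightarrow> holds r e = holds r e')"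

lemma invariantD: "invariant E N r \<Longrightarrow> E N {..<fst r} e e' \<Longrightarrow> holds r e = holds r e'"
  by (auto simp: invariant_def)

text \<open>An Ehrenfeucht-Fraisse game in which the distance bound \<open>N\<close> plays the part
  of the number of remaining rounds. One direction of \<open>ext\<close> suffices because of
  \<open>sym\<close>.\<close>

locale back_and_forth =
  fixes E :: eqv and R :: zrel
  assumes sym: "E N A e e' \<Longrightarrow> E N A e' e"
    and mono: "E N A e e' \<Longrightarrow> N' \<le> N \<Longrightarrow> A' \<subseteq> A \<Longrightarrow> E N' A' e e'"
    and eq: "E 1 {i, j} e e' \<Longrightarrow> e i = e j \<longleftrightarrow> e' i = e' j"
    and atom: "length vs = fst R \<Longrightarrow> E 1 (set vs) e e' \<Longrightarrow> map e vs \<in> snd R \<longleftrightarrow> map e' vs \<in> snd R"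
    and ext: "finite A \<Longrightarrow> x \<notin> A \<Longrightarrow> 0 \<le> N \<Longrightarrow> E (2 * N + 1) A e e' \<Longrightarrow>
      \<exists>b. E N (insert x A) (e(x := a)) (e'(x := b))"
begin

lemma sat_invariant: "over {R} \<phi> \<Longrightarrow> \<exists>N\<ge>0. \<forall>e e'. E N (fv \<phi>) e e' \<longrightarrow> sat e \<phi> = sat e' \<phi>"
proof (induction \<phi>)
  case (Eq i j)
  show ?case by (rule exI[of _ 1]) (simp add: eq)
next
  case (Atom Q vs)
  then show ?case using atom by (intro exI[of _ 1]) simp
next
  case (Neg \<phi>)
  then show ?case by (simp only: over_simps fv.simps sat.simps) blast
next
  case (Conj \<phi> \<psi>)
  then obtain M N where "M \<ge> 0" "\<forall>e e'. E M (fv \<phi>) e e' \<longrightarrow> sat e \<phi> = sat e' \<phi>"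
    "N \<ge> 0" "\<forall>e e'. E N (fv \<psi>) e e' \<longrightarrow> sat e \<psi> = sat e' \<psi>"
    by (simp only: over_simps) blast
  then have "sat e (Conj \<phi> \<psi>) = sat e' (Conj \<phi> \<psi>)"
    if "E (max M N) (fv (Conj \<phi> \<psi>)) e e'" for e e'
    using mono[OF that, of M "fv \<phi>"] mono[OF that, of N "fv \<psi>"]
    by (simp only: sat.simps fv.simps max.cobounded1 max.cobounded2 Un_upper1 Un_upper2 HOL.simp_thms)
       blast
  with \<open>M \<ge> 0\<close> show ?case by (intro exI[of _ "max M N"]) (simp del: sat.simps fv.simps)
next
  case (Ex x \<phi>)
  then obtain N where N: "N \<ge> 0" "\<And>e e'. E N (fv \<phi>) e e' \<Longrightarrow> sat e \<phi> = sat e' \<phi>"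
    by (simp only: over_simps) blast
  have *: "sat e' (Ex x \<phi>)" if E: "E (2 * N + 1) (fv (Ex x \<phi>)) e e'" and "sat e (Ex x \<phi>)" for e e'
  proof -
    obtain a where a: "sat (e(x := a)) \<phi>" using \<open>sat e (Ex x \<phi>)\<close> by auto
    obtain b where b: "E N (insert x (fv \<phi> - {x})) (e(x := a)) (e'(x := b))"
      using ext[of "fv \<phi> - {x}" x N e e' a] E N(1) by auto
    \<comment> \<open>\<open>ext\<close> always adds \<open>x\<close>; monotonicity covers the case
      that \<open>x\<close> is not free in \<open>\<phi>\<close>.\<close>
    have "E N (fv \<phi>) (e(x := a)) (e'(x := b))"
      by (rule mono[OF b]) auto
    with N(2) a show ?thesis by auto
  qed
  have "sat e (Ex x \<phi>) = sat e' (Ex x \<phi>)" if "E (2 * N + 1) (fv (Ex x \<phi>)) e e'" for e e'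
    using *[OF that] *[OF sym[OF that]] by blast
  with N(1) show ?case by (intro exI[of _ "2 * N + 1"]) (simp del: sat.simps fv.simps)
qed

lemma span_invariant:
  assumes "r \<in> span R" shows "\<exists>N\<ge>0. invariant E N r"
proof -
  obtain \<phi> where \<phi>: "over {R} \<phi>" "fv \<phi> \<subseteq> {..<fst r}" "\<forall>e. sat e \<phi> = holds r e"
    using assms by (auto simp: span_def definable_iff fdef_def)
  obtain N where N: "N \<ge> 0" "\<forall>e e'. E N (fv \<phi>) e e' \<longrightarrow> sat e \<phi> = sat e' \<phi>"
    using sat_invariant[OF \<phi>(1)] by blast
  have "holds r e = holds r e'" if "E N {..<fst r} e e'" for e e'
    using mono[OF that order.refl \<phi>(2)] N(2) \<phi>(3) by blast
  with N(1) show ?thesis by (auto simp: invariant_def)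
qed

end

section \<open>Truncated differences and the equivalences for order, successor and cycle\<close>

definition trunc_eq :: "int \<Rightarrow> int \<Rightarrow> int \<Rightarrow> bool" where
  "trunc_eq N d d' \<longleftrightarrow> d = d' \<or> N < d \<and> N < d' \<or> d < - N \<and> d' < - N"

definition lt_eq :: eqv where
  "lt_eq N A e e' \<longleftrightarrow> (\<forall>i\<in>A. \<forall>j\<in>A. trunc_eq N (e i - e j) (e' i - e' j))"

text \<open>Compared with \<open>lt_eq\<close>, the sign of a far difference is forgotten: the
  successor cannot see on which side a far point lies.\<close>

definition succ_eq :: eqv where
  "succ_eq N A e e' \<longleftrightarrow>
    (\<forall>i\<in>A. \<forall>j\<in>A. \<bar>e i - e j\<bar> \<le> N \<or> \<bar>e' i - e' j\<bar> \<le> N \<longrightarrow> e i - e j = e' i - e' j)"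

text \<open>Up to \<open>N\<close>-truncated differences, \<open>e'\<close> arises from \<open>e\<close> by moving an initial block \<open>J\<close> to the
  end: an automorphism of the cyclic order in the ultrapower.\<close>
definition rot_eq :: "nat set \<Rightarrow> eqv" where
  "rot_eq J N A e e' \<longleftrightarrow> J \<subseteq> A \<and> lt_eq N J e e' \<and> lt_eq N (A - J) e e' \<and>
    (\<forall>i\<in>J. \<forall>j\<in>A - J. e i + N < e j \<and> e' j + N < e' i)"

definition cyc_eq :: eqv where
  "cyc_eq N A e e' \<longleftrightarrow> (\<exists>J. rot_eq J N A e e')"

lemma succ_eqD:
  "succ_eq N A e e' \<Longrightarrow> i \<in> A \<Longrightarrow> j \<in> A \<Longrightarrow> \<bar>e i - e j\<bar> \<le> N \<or> \<bar>e' i - e' j\<bar> \<le> N \<Longrightarrow>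
    e i - e j = e' i - e' j"
  unfolding succ_eq_def by blast

lemma succ_eqI:
  "(\<And>i j. i \<in> A \<Longrightarrow> j \<in> A \<Longrightarrow> \<bar>e i - e j\<bar> \<le> N \<or> \<bar>e' i - e' j\<bar> \<le> N \<Longrightarrow>
    e i - e j = e' i - e' j) \<Longrightarrow> succ_eq N A e e'"
  unfolding succ_eq_def by blast

lemma finite_maximizer:
  fixes f :: "'a \<Rightarrow> int"
  assumes "finite A" "A \<noteq> {}"
  shows "\<exists>m\<in>A. \<forall>i\<in>A. f i \<le> f m"
proof -
  have "Max (f ` A) \<in> f ` A" using assms by simp
  then obtain m where m: "m \<in> A" "f m = Max (f ` A)" by force
  moreover have "f i \<le> f m" if "i \<in> A" for i using that assms(1) by (simp add: m(2))
  ultimately show ?thesis by blast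
qed

lemma finite_minimizer:
  fixes f :: "'a \<Rightarrow> int"
  assumes "finite A" "A \<noteq> {}"
  shows "\<exists>m\<in>A. \<forall>i\<in>A. f m \<le> f i"
  using finite_maximizer[OF assms, of "\<lambda>i. - f i"] by simp

lemma trunc_sym: "trunc_eq N d d' \<Longrightarrow> trunc_eq N d' d"
  unfolding trunc_eq_def by blast

lemma trunc_trans: "trunc_eq N d d' \<Longrightarrow> trunc_eq N d' d'' \<Longrightarrow> 0 \<le> N \<Longrightarrow> trunc_eq N d d''"
  unfolding trunc_eq_def by linarith

lemma trunc_mono: "trunc_eq N d d' \<Longrightarrow> N' \<le> N \<Longrightarrow> trunc_eq N' d d'"
  unfolding trunc_eq_def by linarith

lemma trunc_less: "0 \<le> N \<Longrightarrow> trunc_eq N d d' \<Longrightarrow> d < 0 \<longleftrightarrow> d' < 0"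
  unfolding trunc_eq_def by linarith

lemma trunc_gt: "0 \<le> N \<Longrightarrow> trunc_eq N d d' \<Longrightarrow> N < d \<longleftrightarrow> N < d'"
  unfolding trunc_eq_def by linarith

lemma lt_eq_sym: "lt_eq N A e e' \<Longrightarrow> lt_eq N A e' e"
  unfolding lt_eq_def using trunc_sym by blast

lemma lt_eq_trans: "lt_eq N A e e' \<Longrightarrow> lt_eq N A e' e'' \<Longrightarrow> 0 \<le> N \<Longrightarrow> lt_eq N A e e''"
  unfolding lt_eq_def using trunc_trans by blast

lemma lt_eq_mono: "lt_eq N A e e' \<Longrightarrow> N' \<le> N \<Longrightarrow> A' \<subseteq> A \<Longrightarrow> lt_eq N' A' e e'"
  unfolding lt_eq_def using trunc_mono by blast

lemma lt_eq_insert: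
  assumes "0 \<le> N" "lt_eq N A e e'" "x \<notin> A"
    "\<And>i. i \<in> A \<Longrightarrow> trunc_eq N (a - e i) (b - e' i)"
  shows "lt_eq N (insert x A) (e(x := a)) (e'(x := b))"
proof -
  have "trunc_eq N (e i - a) (e' i - b)" if "i \<in> A" for i
    using assms(4)[OF that] unfolding trunc_eq_def by linarith
  moreover have "trunc_eq N 0 0" by (simp add: trunc_eq_def)
  ultimately show ?thesis using assms unfolding lt_eq_def by auto
qed

text \<open>A new point within \<open>N\<close> of some \<open>e i\<close> is copied with the same
  offset from \<open>e' i\<close>. Any other new point lies in a gap that is wide enough to have a
  wide counterpart in \<open>e'\<close>.\<close>

lemma lt_eq_extend:
  assumes "finite A" "x \<notin> A" "0 \<le> N" and E: "lt_eq (2 * N + 1) A e e'"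
  shows "\<exists>b. lt_eq N (insert x A) (e(x := a)) (e'(x := b))"
proof -
  have cl: "trunc_eq (2 * N + 1) (e i - e j) (e' i - e' j)" if "i \<in> A" "j \<in> A" for i j
    using E that by (auto simp: lt_eq_def)
  have *: "\<exists>b. \<forall>i\<in>A. trunc_eq N (a - e i) (b - e' i)"
  proof (cases "\<exists>i\<in>A. \<bar>a - e i\<bar> \<le> N")
    case True
    then obtain i where i: "i \<in> A" "\<bar>a - e i\<bar> \<le> N" by blast
    have "trunc_eq N (a - e j) ((e' i + (a - e i)) - e' j)" if "j \<in> A" for j
      using cl[OF i(1) that] i(2) assms(3) unfolding trunc_eq_def by linarith
    then show ?thesis by blast
  next
    case far: False
    define L where "L = {i \<in> A. e i < a}"
    show ?thesis
    proof (cases "L = {}")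
      case True
      define b where "b = (if A = {} then 0 else Min (e' ` A) - N - 1)"
      have "trunc_eq N (a - e j) (b - e' j)" if "j \<in> A" for j
      proof -
        have "Min (e' ` A) \<le> e' j" using that assms(1) by simp
        moreover have "b = Min (e' ` A) - N - 1" using that by (auto simp: b_def)
        moreover have "a - e j < - N" using far that True unfolding L_def by force
        ultimately show ?thesis unfolding trunc_eq_def by linarith
      qed
      then show ?thesis by blast
    next
      case False
      have "finite L" using assms(1) by (simp add: L_def)
      then obtain m where m: "m \<in> L" "\<And>i. i \<in> L \<Longrightarrow> e i \<le> e m"
        using False finite_maximizer[of L e] by blast
      \<comment> \<open>The new value lies just out of reach above the image of the largest point
        below \<open>a\<close>. Points above \<open>a\<close> are at least \<open>2 * N + 2\<close>
        above \<open>e m\<close>, so their images stay more than \<open>N\<close> above the new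
        value; this uses the \<open>+ 1\<close> of the bound.\<close>
      have "trunc_eq N (a - e j) ((e' m + N + 1) - e' j)" if "j \<in> A" for j
      proof (cases "j \<in> L")
        case True
        have "e j \<le> e m" "a - e j > N" using m True far unfolding L_def by force+
        then show ?thesis
          using cl[of m j] that m(1) assms(3) unfolding L_def trunc_eq_def by auto
      next
        case False
        then have "a - e j < - N" "a - e m > N" using m(1) far that unfolding L_def by force+
        then show ?thesis
          using cl[of m j] that m(1) assms(3) unfolding L_def trunc_eq_def by auto
      qed
      then show ?thesis by blast
    qed
  qed
  have "lt_eq N A e e'" using lt_eq_mono[OF E, of N A] assms(3) by simp
  moreover obtain b where "\<And>i. i \<in> A \<Longrightarrow> trunc_eq N (a - e i) (b - e' i)"
    using * by blast
  ultimately have "lt_eq N (insert x A) (e(x := a)) (e'(x := b))"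
    using assms(2,3) by (intro lt_eq_insert)
  then show ?thesis by blast
qed

interpretation lt: back_and_forth lt_eq lt_rel
proof
  fix vs :: "nat list" and e e' assume "length vs = fst lt_rel" and E: "lt_eq 1 (set vs) e e'"
  then obtain i j where vs: "vs = [i, j]"
    by (auto simp: lt_rel_def length_Suc_conv numeral_2_eq_2)
  then have "trunc_eq 1 (e i - e j) (e' i - e' j)"
    using E by (simp add: lt_eq_def)
  then show "map e vs \<in> snd lt_rel \<longleftrightarrow> map e' vs \<in> snd lt_rel"
    using trunc_less[of 1 "e i - e j" "e' i - e' j"] by (simp add: vs lt_rel_def)
next
  fix i j e e' assume "lt_eq 1 {i, j} e e'"
  then have "trunc_eq 1 (e i - e j) (e' i - e' j)"
    by (simp add: lt_eq_def)
  then show "e i = e j \<longleftrightarrow> e' i = e' j" unfolding trunc_eq_def by linarith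
next
  fix N A e e' assume "lt_eq N A e e'"
  then show "lt_eq N A e' e" by (rule lt_eq_sym)
next
  fix N N' A A' e e' assume "lt_eq N A e e'" "N' \<le> N" "A' \<subseteq> A"
  then show "lt_eq N' A' e e'" by (rule lt_eq_mono)
next
  fix A :: "nat set" and x N e e' a
  assume "finite A" "x \<notin> A" "0 \<le> N" "lt_eq (2 * N + 1) A e e'"
  then show "\<exists>b. lt_eq N (insert x A) (e(x := a)) (e'(x := b))" by (rule lt_eq_extend)
qed

interpretation succ: back_and_forth succ_eq succ_rel
proof
  fix N N' A A' e e' assume *: "succ_eq N A e e'" "N' \<le> N" "A' \<subseteq> A"
  show "succ_eq N' A' e e'"
  proof (rule succ_eqI)
    fix i j assume "i \<in> A'" "j \<in> A'" "\<bar>e i - e j\<bar> \<le> N' \<or> \<bar>e' i - e' j\<bar> \<le> N'"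
    then show "e i - e j = e' i - e' j" using *(2,3) by (intro succ_eqD[OF *(1)]) auto
  qed
next
  fix vs :: "nat list" and e e' assume "length vs = fst succ_rel" and E: "succ_eq 1 (set vs) e e'"
  then obtain i j where vs: "vs = [i, j]"
    by (auto simp: succ_rel_def length_Suc_conv numeral_2_eq_2)
  then have "\<bar>e j - e i\<bar> \<le> 1 \<or> \<bar>e' j - e' i\<bar> \<le> 1 \<longrightarrow> e j - e i = e' j - e' i"
    using succ_eqD[OF E, of j i] by auto
  then show "map e vs \<in> snd succ_rel \<longleftrightarrow> map e' vs \<in> snd succ_rel"
    by (simp add: vs succ_rel_def) linarith
next
  fix A :: "nat set" and x N e e' a
  assume A: "finite A" "x \<notin> A" "0 \<le> N" and E: "succ_eq (2 * N + 1) A e e'"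
  note E = succ_eqD[OF E]
  have "\<exists>b. \<forall>i\<in>A. \<bar>a - e i\<bar> \<le> N \<or> \<bar>b - e' i\<bar> \<le> N \<longrightarrow> a - e i = b - e' i"
  proof (cases "\<exists>i\<in>A. \<bar>a - e i\<bar> \<le> N")
    case True
    then obtain i where i: "i \<in> A" "\<bar>a - e i\<bar> \<le> N" by blast
    have "a - e j = e' i + (a - e i) - e' j"
      if "j \<in> A" "\<bar>a - e j\<bar> \<le> N \<or> \<bar>e' i + (a - e i) - e' j\<bar> \<le> N" for j
    proof -
      have "\<bar>e i - e j\<bar> \<le> 2 * N + 1 \<or> \<bar>e' i - e' j\<bar> \<le> 2 * N + 1" using i(2) that(2) by linarith
      with E[OF i(1) that(1)] show ?thesis by simp
    qed
    then show ?thesis by blast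
  next
    case far: False
    \<comment> \<open>Far points carry no sign here, so a value beyond all of \<open>e'\<close>
      serves, whatever the position of \<open>a\<close>.\<close>
    obtain b where "\<And>i. i \<in> A \<Longrightarrow> e' i < b"
    proof (cases "A = {}")
      case False
      with A(1) obtain m where "\<forall>i\<in>A. e' i \<le> e' m" using finite_maximizer[of A e'] by blast
      then show ?thesis using that[of "e' m + 1"] by force
    qed (use that in simp)
    then have "\<bar>b + N - e' i\<bar> > N" if "i \<in> A" for i using that A(3) by force
    with far show ?thesis by (intro exI[of _ "b + N"]) force
  qed
  then obtain b where b: "\<And>i. i \<in> A \<Longrightarrow> \<bar>a - e i\<bar> \<le> N \<or> \<bar>b - e' i\<bar> \<le> N \<Longrightarrow> a - e i = b - e' i"
    by blast
  have "succ_eq N (insert x A) (e(x := a)) (e'(x := b))"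
  proof (rule succ_eqI)
    fix i j assume ij: "i \<in> insert x A" "j \<in> insert x A"
      and le: "\<bar>(e(x := a)) i - (e(x := a)) j\<bar> \<le> N \<or> \<bar>(e'(x := b)) i - (e'(x := b)) j\<bar> \<le> N"
    consider "i = x" "j = x" | "i = x" "j \<in> A" "j \<noteq> x" | "i \<in> A" "j = x" "i \<noteq> x" | "i \<in> A" "j \<in> A" "i \<noteq> x" "j \<noteq> x"
      using ij A(2) by blast
    then show "(e(x := a)) i - (e(x := a)) j = (e'(x := b)) i - (e'(x := b)) j"
    proof cases
      case 2 then show ?thesis using b[of j] le by simp
    next
      case 3 then show ?thesis using b[of i] le by (simp add: abs_minus_commute)
    next
      case 4
      then have "\<bar>e i - e j\<bar> \<le> 2 * N + 1 \<or> \<bar>e' i - e' j\<bar> \<le> 2 * N + 1" using le A(3) by auto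
      with E[of i j] 4 show ?thesis by simp
    qed simp
  qed
  then show "\<exists>b. succ_eq N (insert x A) (e(x := a)) (e'(x := b))" by blast
next
  show "succ_eq N A e' e" if "succ_eq N A e e'" for N A e e'
  proof (rule succ_eqI)
    show "e' i - e' j = e i - e j"
      if "i \<in> A" "j \<in> A" "\<bar>e' i - e' j\<bar> \<le> N \<or> \<bar>e i - e j\<bar> \<le> N" for i j
      using succ_eqD[OF \<open>succ_eq N A e e'\<close>, of i j] that by argo
  qed
  show "e i = e j \<longleftrightarrow> e' i = e' j" if "succ_eq 1 {i, j} e e'" for i j e e'
    using succ_eqD[OF that, of i j] by fastforce
qed

section \<open>Rotations of blocks and the cyclic order\<close>

lemma finite_bound:
  fixes f :: "'a \<Rightarrow> int"
  assumes "finite A" obtains L where "0 \<le> L" "\<And>i. i \<in> A \<Longrightarrow> \<bar>f i\<bar> \<le> L"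
proof (cases "A = {}")
  case False
  with assms obtain m where "m \<in> A" "\<forall>i\<in>A. \<bar>f i\<bar> \<le> \<bar>f m\<bar>"
    using finite_maximizer[of A "\<lambda>i. \<bar>f i\<bar>"] by blast
  then show ?thesis using that[of "\<bar>f m\<bar>"] by simp
qed (use that[of 0] in simp)

lemma rot_eq_sym:
  assumes "rot_eq J N A e e'" shows "rot_eq (A - J) N A e' e"
proof -
  have "A - (A - J) = J" using assms by (auto simp: rot_eq_def)
  with assms show ?thesis by (auto simp: rot_eq_def intro: lt_eq_sym)
qed

lemma rot_eq_mono:
  assumes "rot_eq J N A e e'" "N' \<le> N" "A' \<subseteq> A"
  shows "rot_eq (J \<inter> A') N' A' e e'"
  unfolding rot_eq_def
proof (intro conjI ballI)
  show "lt_eq N' (J \<inter> A') e e'" "lt_eq N' (A' - J \<inter> A') e e'"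
    using assms by (auto simp: rot_eq_def intro: lt_eq_mono)
  fix i j assume "i \<in> J \<inter> A'" "j \<in> A' - J \<inter> A'"
  then have "e i + N < e j \<and> e' j + N < e' i" using assms by (auto simp: rot_eq_def)
  then show "e i + N' < e j" "e' j + N' < e' i" using assms(2) by auto
qed simp

text \<open>Lifting \<open>J\<close> above everything else by a large \<open>T\<close> turns a
  rotation into a plain \<open>lt_eq\<close>. Together with the converse below, this carries the
  extension step from \<open>lt_eq\<close> over to rotations.\<close>

lemma rot_eq_of_shift:
  assumes "0 \<le> N" "J \<subseteq> A" "lt_eq N A (\<lambda>i. if i \<in> J then e i + T else e i) e'"
    and "\<And>i j. i \<in> J \<Longrightarrow> j \<in> A - J \<Longrightarrow> e i + N < e j \<and> e j + N < e i + T"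
  shows "rot_eq J N A e e'"
proof -
  have tr: "trunc_eq N ((if i \<in> J then e i + T else e i) - (if j \<in> J then e j + T else e j)) (e' i - e' j)"
    if "i \<in> A" "j \<in> A" for i j
    using assms(3) that by (simp add: lt_eq_def)
  have "lt_eq N J e e'" unfolding lt_eq_def
  proof (intro ballI)
    fix i j assume "i \<in> J" "j \<in> J"
    then show "trunc_eq N (e i - e j) (e' i - e' j)" using tr[of i j] assms(2) by auto
  qed
  moreover have "lt_eq N (A - J) e e'" unfolding lt_eq_def
  proof (intro ballI)
    fix i j assume "i \<in> A - J" "j \<in> A - J"
    then show "trunc_eq N (e i - e j) (e' i - e' j)" using tr[of i j] by auto
  qed
  moreover have "e' j + N < e' i" if "i \<in> J" "j \<in> A - J" for i j
    using tr[of i j] assms(4)[OF that] trunc_gt[OF assms(1)] assms(2) that by force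
  ultimately show ?thesis using assms(2,4) by (simp add: rot_eq_def)
qed

lemma shift_of_rot_eq:
  assumes "rot_eq J N A e e'" "\<And>i j. i \<in> J \<Longrightarrow> j \<in> A - J \<Longrightarrow> e j + N < e i + T"
  shows "lt_eq N A (\<lambda>i. if i \<in> J then e i + T else e i) e'"
  unfolding lt_eq_def
proof (intro ballI)
  fix i j assume ij: "i \<in> A" "j \<in> A"
  consider "i \<in> J" "j \<in> J" | "i \<in> A - J" "j \<in> A - J" | "i \<in> J" "j \<in> A - J" | "i \<in> A - J" "j \<in> J"
    using ij by blast
  then show "trunc_eq N ((if i \<in> J then e i + T else e i) - (if j \<in> J then e j + T else e j)) (e' i - e' j)"
  proof cases
    case 3
    then have "e' j + N < e' i" using assms(1) by (simp add: rot_eq_def)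
    with 3 assms(2)[OF 3] show ?thesis by (auto simp: trunc_eq_def)
  next
    case 4
    then have "e' i + N < e' j" using assms(1) by (simp add: rot_eq_def)
    with 4 assms(2)[of j i] show ?thesis by (auto simp: trunc_eq_def)
  qed (use assms(1) in \<open>auto simp: rot_eq_def lt_eq_def\<close>)
qed

text \<open>The rotation is straightened by a shift, \<open>lt_eq_extend\<close> finds the new
  value, and the shift is undone after deciding whether the new point belongs to the moved
  block.\<close>

lemma rot_eq_extend:
  assumes A: "finite A" "x \<notin> A" and N: "0 \<le> N" and rot: "rot_eq J (2 * N + 1) A e e'"
  shows "\<exists>b. cyc_eq N (insert x A) (e(x := a)) (e'(x := b))"
proof -
  have cross: "e i + (2 * N + 1) < e j" if "i \<in> J" "j \<in> A - J" for i j
    using rot that by (auto simp: rot_eq_def)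
  have JA: "J \<subseteq> A" using rot by (simp add: rot_eq_def)
  have "finite (insert x A)" using A(1) by simp
  then obtain L where L: "0 \<le> L" "\<And>i. i \<in> insert x A \<Longrightarrow> \<bar>(e(x := a)) i\<bar> \<le> L"
    using finite_bound[of "insert x A" "e(x := a)"] by blast
  have La: "\<bar>a\<bar> \<le> L" using L(2)[of x] by simp
  have Le: "\<bar>e i\<bar> \<le> L" if "i \<in> A" for i using L(2)[of i] that A(2) by (cases "i = x") auto
  \<comment> \<open>Values differ by at most \<open>2 * L\<close>, so the lifted block clears the
    rest by more than \<open>2 * N + 1\<close>. The bound \<open>L\<close> also covers the new value
    \<open>a\<close>.\<close>
  define T where "T = 2 * L + 2 * N + 2"
  define s where "s = (\<lambda>i. if i \<in> J then e i + T else e i)"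
  have up: "e j + (2 * N + 1) < e i + T" if "i \<in> A" "j \<in> A" for i j
    using Le[OF that(1)] Le[OF that(2)] N by (simp add: T_def)
  have s: "lt_eq (2 * N + 1) A s e'"
    unfolding s_def using JA up by (intro shift_of_rot_eq[OF rot]) auto
  show ?thesis
  \<comment> \<open>A point at most \<open>N\<close> above a member of \<open>J\<close> has to move
    along; the margin \<open>2 * N + 1\<close> keeps it more than \<open>N\<close> below the rest.
    Otherwise it is more than \<open>N\<close> above all of \<open>J\<close> and stays.\<close>
  proof (cases "\<exists>i\<in>J. a \<le> e i + N")
    case True
    then obtain m where m: "m \<in> J" "a \<le> e m + N" by blast
    obtain b where b: "lt_eq N (insert x A) (s(x := a + T)) (e'(x := b))"
      using lt_eq_extend[OF A N s] by blast
    have "s(x := a + T) =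
        (\<lambda>i. if i \<in> insert x J then (e(x := a)) i + T else (e(x := a)) i)"
      by (auto simp: s_def)
    with b have b': "lt_eq N (insert x A)
        (\<lambda>i. if i \<in> insert x J then (e(x := a)) i + T else (e(x := a)) i) (e'(x := b))"
      by simp
    have "rot_eq (insert x J) N (insert x A) (e(x := a)) (e'(x := b))"
    proof (rule rot_eq_of_shift[OF N _ b'])
      show "insert x J \<subseteq> insert x A" using JA by blast
      fix i j assume i: "i \<in> insert x J" and "j \<in> insert x A - insert x J"
      then have j: "j \<in> A - J" "j \<noteq> x" by auto
      show "(e(x := a)) i + N < (e(x := a)) j \<and> (e(x := a)) j + N < (e(x := a)) i + T"
      proof (cases "i = x")
        case True
        then show ?thesis using cross[OF m(1) j(1)] m(2) j La Le[of j] N by (simp add: T_def)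
      next
        case False
        then show ?thesis using cross[of i j] up[of i j] i j JA N by auto
      qed
    qed
    then show ?thesis unfolding cyc_eq_def by blast
  next
    case False
    obtain b where b: "lt_eq N (insert x A) (s(x := a)) (e'(x := b))"
      using lt_eq_extend[OF A N s] by blast
    have "s(x := a) = (\<lambda>i. if i \<in> J then (e(x := a)) i + T else (e(x := a)) i)"
      using JA A(2) by (fastforce simp: s_def fun_eq_iff)
    with b have b': "lt_eq N (insert x A)
        (\<lambda>i. if i \<in> J then (e(x := a)) i + T else (e(x := a)) i) (e'(x := b))"
      by simp
    have "rot_eq J N (insert x A) (e(x := a)) (e'(x := b))"
    proof (rule rot_eq_of_shift[OF N _ b'])
      show "J \<subseteq> insert x A" using JA by blast
      fix i j assume i: "i \<in> J" and j: "j \<in> insert x A - J"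
      have "i \<noteq> x" using i JA A(2) by blast
      show "(e(x := a)) i + N < (e(x := a)) j \<and> (e(x := a)) j + N < (e(x := a)) i + T"
      proof (cases "j = x")
        case True
        have "e i + N < a" using False i by force
        with True \<open>i \<noteq> x\<close> show ?thesis using La Le[of i] N i JA by (auto simp: T_def)
      next
        case False
        then show ?thesis using cross[of i j] up[of i j] i j JA N \<open>i \<noteq> x\<close> by auto
      qed
    qed
    then show ?thesis unfolding cyc_eq_def by blast
  qed
qed

definition cyc :: "int \<Rightarrow> int \<Rightarrow> int \<Rightarrow> bool" where
  "cyc a b c \<longleftrightarrow> a < b \<and> b < c \<or> b < c \<and> c < a \<or> c < a \<and> a < b"

lemma C_rel_iff: "[a, b, c] \<in> snd C_rel \<longleftrightarrow> cyc a b c"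
  by (simp add: C_rel_def cyc_def)

lemma rot_eq_less:
  assumes "rot_eq J N A e e'" "0 \<le> N" "i \<in> A" "j \<in> A"
  shows "(i \<in> J \<longleftrightarrow> j \<in> J) \<Longrightarrow> e i < e j \<longleftrightarrow> e' i < e' j"
    and "i \<in> J \<Longrightarrow> j \<notin> J \<Longrightarrow> e i < e j \<and> e' j < e' i"
proof -
  assume "i \<in> J \<longleftrightarrow> j \<in> J"
  then have "trunc_eq N (e i - e j) (e' i - e' j)"
    using assms by (auto simp: rot_eq_def lt_eq_def)
  then show "e i < e j \<longleftrightarrow> e' i < e' j" using trunc_less[OF assms(2)] by fastforce
next
  assume "i \<in> J" "j \<notin> J"
  then have "e i + N < e j \<and> e' j + N < e' i" using assms by (auto simp: rot_eq_def)
  with assms(2) show "e i < e j \<and> e' j < e' i" by linarith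
qed

lemma rot_eq_cyc:
  assumes "rot_eq J N A e e'" "0 \<le> N" "i \<in> A" "j \<in> A" "k \<in> A"
  shows "cyc (e i) (e j) (e k) \<longleftrightarrow> cyc (e' i) (e' j) (e' k)"
proof -
  note less = rot_eq_less[OF assms(1,2)]
  show ?thesis
    using less[OF assms(3,4)] less[OF assms(3,5)] less[OF assms(4,5)]
      less[OF assms(4,3)] less[OF assms(5,3)] less[OF assms(5,4)]
    unfolding cyc_def by (cases "i \<in> J"; cases "j \<in> J"; cases "k \<in> J") auto
qed

interpretation cyc: back_and_forth cyc_eq C_rel
proof
  fix N A e e' assume "cyc_eq N A e e'"
  then show "cyc_eq N A e' e" unfolding cyc_eq_def using rot_eq_sym by blast
next
  fix N N' A A' e e' assume "cyc_eq N A e e'" "N' \<le> N" "A' \<subseteq> A"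
  then show "cyc_eq N' A' e e'" unfolding cyc_eq_def using rot_eq_mono by blast
next
  fix i j e e' assume "cyc_eq 1 {i, j} e e'"
  then obtain J where J: "rot_eq J 1 {i, j} e e'" by (auto simp: cyc_eq_def)
  show "e i = e j \<longleftrightarrow> e' i = e' j"
    using rot_eq_less[OF J, of i j] rot_eq_less[OF J, of j i]
    by (cases "i \<in> J"; cases "j \<in> J") auto
next
  fix vs :: "nat list" and e e' assume "length vs = fst C_rel" and E: "cyc_eq 1 (set vs) e e'"
  then obtain i j k where vs: "vs = [i, j, k]"
    by (auto simp: C_rel_def length_Suc_conv numeral_3_eq_3)
  obtain J where J: "rot_eq J 1 {i, j, k} e e'" using E by (auto simp: cyc_eq_def vs)
  show "map e vs \<in> snd C_rel \<longleftrightarrow> map e' vs \<in> snd C_rel"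
    using rot_eq_cyc[OF J, of i j k] by (simp add: vs C_rel_iff)
next
  fix A :: "nat set" and x N e e' a
  assume "finite A" "x \<notin> A" "0 \<le> N" "cyc_eq (2 * N + 1) A e e'"
  then show "\<exists>b. cyc_eq N (insert x A) (e(x := a)) (e'(x := b))"
    unfolding cyc_eq_def[of "2 * N + 1"] using rot_eq_extend by blast
qed

lemma cyc_eq_of_lt_eq: "lt_eq N A e e' \<Longrightarrow> cyc_eq N A e e'"
  unfolding cyc_eq_def by (rule exI[of _ "{}"]) (simp add: rot_eq_def lt_eq_def)

lemma invariant_lt_of_cyc: "invariant cyc_eq N r \<Longrightarrow> invariant lt_eq N r"
  unfolding invariant_def using cyc_eq_of_lt_eq by blast

lemma lt_eq_translate: "lt_eq N A (\<lambda>i. c + e i) e"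
  by (simp add: lt_eq_def trunc_eq_def)

section \<open>Reflection invariance\<close>

definition refl_inv :: "zrel \<Rightarrow> bool" where
  "refl_inv r \<longleftrightarrow> (\<forall>e. holds r (\<lambda>i. - e i) = holds r e)"

lemma holds_nth:
  assumes "length vs = fst r" shows "map e vs \<in> snd r \<longleftrightarrow> holds r (\<lambda>i. e (vs ! i))"
proof -
  have m: "map (\<lambda>i. e (vs ! i)) [0..<fst r] = map e vs"
    by (rule nth_equalityI) (simp_all add: assms)
  show ?thesis by (simp only: holds_def m)
qed

lemma sat_refl:
  assumes "\<And>Q. Q \<in> V \<Longrightarrow> refl_inv Q"
  shows "over V \<phi> \<Longrightarrow> sat (\<lambda>i. - e i) \<phi> = sat e \<phi>"
proof (induction \<phi> arbitrary: e)
  case (Atom Q vs)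
  then have "Q \<in> V" "length vs = fst Q" by auto
  then show ?case
    using assms[of Q, unfolded refl_inv_def, rule_format, of "\<lambda>i. e (vs ! i)"]
    by (simp only: sat.simps holds_nth)
next
  case (Ex x \<phi>)
  have IH: "sat (\<lambda>i. - f i) \<phi> = sat f \<phi>" for f
    using Ex by simp
  have eq: "(\<lambda>i. - (e(x := a)) i) = (\<lambda>i. - e i)(x := - a)" for a
    by auto
  have "sat ((\<lambda>i. - e i)(x := - a)) \<phi> = sat (e(x := a)) \<phi>" for a
    using IH[of "e(x := a)"] by (simp only: eq)
  then show ?case unfolding sat.simps by (metis minus_minus)
qed auto

lemma refl_inv_gen:
  assumes "\<And>Q. Q \<in> V \<Longrightarrow> refl_inv Q" "r \<in> gen V" shows "refl_inv r"
proof -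
  obtain \<phi> where "over V \<phi>" "\<forall>e. sat e \<phi> = holds r e"
    using assms(2) by (auto simp: gen_def definable_iff fdef_def)
  with sat_refl[OF assms(1)] show ?thesis unfolding refl_inv_def by metis
qed

section \<open>Definability criteria\<close>

lemma fdef_cong: "(\<And>e. P e = Q e) \<Longrightarrow> fdef V n P \<Longrightarrow> fdef V n Q"
  unfolding fdef_def by simp

lemma fdef_mono: "fdef V n P \<Longrightarrow> n \<le> m \<Longrightarrow> fdef V m P"
  unfolding fdef_def by fastforce

text \<open>Substitution of definable functions \<open>ts\<close> into a relation. Each term in turn
  becomes a fresh quantified variable \<open>m\<close> and is appended to \<open>vs\<close>. The
  guard \<open>G\<close> restricts to assignments where the graphs of the terms are definable, such
  as those with a fixed edge.\<close>

lemma fdef_subst_aux: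
  assumes r: "r \<in> V" and G: "fdef V n G" "\<And>e m a. n \<le> m \<Longrightarrow> G (e(m := a)) = G e"
  shows "(\<And>t m. t \<in> set ts \<Longrightarrow> n \<le> m \<Longrightarrow> fdef V (Suc m) (\<lambda>e. G e \<and> e m = t e)) \<Longrightarrow>
    (\<And>t m e a. t \<in> set ts \<Longrightarrow> n \<le> m \<Longrightarrow> t (e(m := a)) = t e) \<Longrightarrow>
    n \<le> m \<Longrightarrow> set vs \<subseteq> {..<m} \<Longrightarrow> length vs + length ts = fst r \<Longrightarrow>
    fdef V m (\<lambda>e. G e \<and> map e vs @ map (\<lambda>t. t e) ts \<in> snd r)"
proof (induction ts arbitrary: m vs)
  case Nil
  then have "fdef V m (\<lambda>e. G e \<and> map e vs \<in> snd r)"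
    by (intro fdef_conj fdef_atom r fdef_mono[OF G(1)]) auto
  then show ?case by simp
next
  case (Cons t ts)
  have vs: "fdef V (Suc m) (\<lambda>e. G e \<and> map e (vs @ [m]) @ map (\<lambda>t. t e) ts \<in> snd r)"
    using Cons.prems by (intro Cons.IH) auto
  have t: "fdef V (Suc m) (\<lambda>e. G e \<and> e m = t e)"
    using Cons.prems by simp
  have *: "fdef V m (\<lambda>e. \<exists>a. (\<lambda>e. (G e \<and> e m = t e) \<and>
      G e \<and> map e (vs @ [m]) @ map (\<lambda>t. t e) ts \<in> snd r) (e(m := a)))"
    by (rule fdef_ex[OF fdef_conj[OF t vs]])
  show ?case
  proof (rule fdef_cong[OF _ *])
    fix e :: "nat \<Rightarrow> int"
    have vs: "map (e(m := a)) (vs @ [m]) = map e vs @ [a]" for a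
      using Cons.prems(4) by auto
    have ts: "map (\<lambda>t. t (e(m := a))) ts = map (\<lambda>t. t e) ts" for a
      using Cons.prems(2)[OF _ Cons.prems(3)] by (simp del: fun_upd_apply)
    have t: "t (e(m := a)) = t e" for a
      using Cons.prems(2)[OF _ Cons.prems(3)] by (simp del: fun_upd_apply)
    show "(\<exists>a. (\<lambda>e. (G e \<and> e m = t e) \<and> G e \<and> map e (vs @ [m]) @ map (\<lambda>t. t e) ts \<in> snd r) (e(m := a)))
        \<longleftrightarrow> G e \<and> map e vs @ map (\<lambda>t. t e) (t # ts) \<in> snd r"
      unfolding vs ts t G(2)[OF Cons.prems(3)] by auto
  qed
qed

lemma fdef_subst:
  assumes r: "r \<in> V" and G: "fdef V n G" "\<And>e m a. n \<le> m \<Longrightarrow> G (e(m := a)) = G e"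
    and t: "\<And>i m. i < fst r \<Longrightarrow> n \<le> m \<Longrightarrow> fdef V (Suc m) (\<lambda>e. G e \<and> e m = t i e)"
      "\<And>i m e a. i < fst r \<Longrightarrow> n \<le> m \<Longrightarrow> t i (e(m := a)) = t i e"
  shows "fdef V n (\<lambda>e. G e \<and> holds r (\<lambda>i. t i e))"
proof -
  have *: "fdef V n (\<lambda>e. G e \<and> map e [] @ map (\<lambda>t. t e) (map t [0..<fst r]) \<in> snd r)"
    by (rule fdef_subst_aux[OF r G, where ts = "map t [0..<fst r]" and m = n and vs = "[]"])
       (use t in auto)
  have "map e [] @ map (\<lambda>t. t e) (map t [0..<fst r]) = map (\<lambda>i. t i e) [0..<fst r]"
    for e :: "nat \<Rightarrow> int"
    by (simp add: o_def)
  with * show ?thesis by (simp only: holds_def)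
qed

lemma snd_rels:
  "[x, y] \<in> snd lt_rel \<longleftrightarrow> x < y"
  "[x, y] \<in> snd succ_rel \<longleftrightarrow> y = x + 1"
  "[x, y, z, t] \<in> snd A11_rel \<longleftrightarrow> x - y = z - t \<and> \<bar>x - y\<bar> = 1"
  by (auto simp: lt_rel_def succ_rel_def A11_rel_def)

lemma fst_rels:
  "fst lt_rel = 2" "fst succ_rel = 2" "fst A11_rel = 4" "fst B_rel = 3" "fst C_rel = 3" "fst S_rel = 4"
  by (simp_all add: lt_rel_def succ_rel_def A11_rel_def B_rel_def C_rel_def S_rel_def)

lemma wf_rels:
  "wf_rel lt_rel" "wf_rel succ_rel" "wf_rel A11_rel" "wf_rel B_rel" "wf_rel C_rel" "wf_rel S_rel"
  by (auto simp: wf_rel_def lt_rel_def succ_rel_def A11_rel_def B_rel_def C_rel_def S_rel_def)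

lemma upt_numerals: "[0..<2] = [0, 1]" "[0..<3] = [0, 1, 2]" "[0..<4] = [0, 1, 2, 3]"
  by (simp_all add: upt_rec)

lemma holds_rels:
  "holds lt_rel e \<longleftrightarrow> e 0 < e 1"
  "holds succ_rel e \<longleftrightarrow> e 1 = e 0 + 1"
  "holds A11_rel e \<longleftrightarrow> e 0 - e 1 = e 2 - e 3 \<and> \<bar>e 0 - e 1\<bar> = 1"
  "holds C_rel e \<longleftrightarrow> cyc (e 0) (e 1) (e 2)"
  "holds B_rel e \<longleftrightarrow> betw (e 0) (e 1) (e 2)"
  "holds S_rel e \<longleftrightarrow> (betw (e 0) (e 1) (e 2) \<or> betw (e 0) (e 3) (e 2)) \<and>
     (betw (e 1) (e 0) (e 3) \<or> betw (e 1) (e 2) (e 3))"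
  by (simp_all add: holds_def fst_rels upt_numerals snd_rels C_rel_iff)
     (simp_all add: B_rel_def S_rel_def)

section \<open>Definability in the presence of the successor\<close>

lemma fdef_succ_nat:
  assumes "succ_rel \<in> V"
  shows "i < n \<Longrightarrow> j < n \<Longrightarrow> fdef V n (\<lambda>e. e j = e i + int d)"
proof (induction d arbitrary: n j)
  case 0
  then show ?case using fdef_eq[of j n i] by simp
next
  case (Suc d)
  have "fdef V (Suc n) (\<lambda>e. e n = e i + int d)"
    using Suc by simp
  moreover have "fdef V (Suc n) (\<lambda>e. map e [n, j] \<in> snd succ_rel)"
    using Suc assms by (intro fdef_atom) (auto simp: fst_rels)
  ultimately have "fdef V n (\<lambda>e. \<exists>a. (\<lambda>e. e n = e i + int d \<and> map e [n, j] \<in> snd succ_rel) (e(n := a)))"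
    by (intro fdef_ex fdef_conj)
  then show ?case
    by (rule fdef_cong[rotated]) (use Suc in \<open>auto simp: snd_rels\<close>)
qed

lemma fdef_succ:
  assumes "succ_rel \<in> V" "i < n" "j < n"
  shows "fdef V n (\<lambda>e. e j = e i + d)"
proof (cases "d \<ge> 0")
  case True
  then show ?thesis using fdef_succ_nat[OF assms, of "nat d"] by simp
next
  case False
  have "fdef V n (\<lambda>e. e i = e j + int (nat (- d)))"
    by (rule fdef_succ_nat[OF assms(1,3,2)])
  then show ?thesis by (rule fdef_cong[rotated]) (use False in auto)
qed

lemma fdef_shift:
  assumes "succ_rel \<in> V" "r \<in> V" "\<And>i. i < fst r \<Longrightarrow> \<sigma> i < n"
  shows "fdef V n (\<lambda>e. holds r (\<lambda>i. e (\<sigma> i) + z i))"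
proof -
  have "fdef V n (\<lambda>e. True \<and> holds r (\<lambda>i. (\<lambda>i e. e (\<sigma> i) + z i) i e))"
  proof (rule fdef_subst[OF assms(2) fdef_const])
    fix i m assume "i < fst r" "n \<le> m"
    then have "\<sigma> i < Suc m" "\<sigma> i \<noteq> m" using assms(3)[of i] by auto
    then show "fdef V (Suc m) (\<lambda>e. True \<and> e m = e (\<sigma> i) + z i)"
      "\<And>e a. (e(m := a)) (\<sigma> i) + z i = e (\<sigma> i) + z i"
      using fdef_succ[OF assms(1), of "\<sigma> i" "Suc m" m "z i"] by simp_all
  qed simp
  then show ?thesis by simp
qed

text \<open>Near differences amount to finitely many tests \<open>e j = e i + d\<close> with
  \<open>\<bar>d\<bar> \<le> N\<close>, all definable from \<open>+1\<close>. Hence \<open>F\<close>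
  only has to separate assignments that have the same near differences.\<close>

lemma fdef_succ_eq_tests:
  assumes "succ_rel \<in> V" "finite F" "\<And>P. P \<in> F \<Longrightarrow> fdef V n P"
    and X: "\<And>e e'. succ_eq N {..<n} e e' \<Longrightarrow> \<forall>P\<in>F. P e = P e' \<Longrightarrow> X e = X e'"
  shows "fdef V n X"
proof (rule fdef_finite_tests)
  define D where "D = (\<lambda>(i, j, d) (e :: nat \<Rightarrow> int). e j = e i + d) ` ({..<n} \<times> {..<n} \<times> {- N..N})"
  show "finite (D \<union> F)" using assms(2) by (simp add: D_def)
  show "fdef V n P" if "P \<in> D \<union> F" for P
    using that assms(3) fdef_succ[OF assms(1)] by (auto simp: D_def)
  show "X e = X e'" if agree: "\<forall>P\<in>D \<union> F. P e = P e'" for e e'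
  proof (rule X)
    show "succ_eq N {..<n} e e'"
    proof (rule succ_eqI)
      fix i j assume ij: "i \<in> {..<n}" "j \<in> {..<n}" "\<bar>e i - e j\<bar> \<le> N \<or> \<bar>e' i - e' j\<bar> \<le> N"
      have eq: "e i = e j + d \<longleftrightarrow> e' i = e' j + d" if "\<bar>d\<bar> \<le> N" for d
      proof -
        have "(j, i, d) \<in> {..<n} \<times> {..<n} \<times> {- N..N}" using ij that by auto
        then have "(\<lambda>(i, j, d) (e :: nat \<Rightarrow> int). e j = e i + d) (j, i, d) \<in> D"
          unfolding D_def by (rule imageI)
        then have "(\<lambda>e :: nat \<Rightarrow> int. e i = e j + d) \<in> D \<union> F" by simp
        from bspec[OF agree this] show ?thesis .
      qed
      from ij(3) show "e i - e j = e' i - e' j"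
      proof
        assume "\<bar>e i - e j\<bar> \<le> N"
        from eq[OF this] show ?thesis by simp
      next
        assume "\<bar>e' i - e' j\<bar> \<le> N"
        from eq[OF this] show ?thesis by simp
      qed
    qed
    show "\<forall>P\<in>F. P e = P e'" by (intro ballI bspec[OF agree] UnI2)
  qed
qed

lemma mem_span_succ:
  assumes "wf_rel r" "invariant succ_eq N r" shows "r \<in> span succ_rel"
proof -
  have "fdef {succ_rel} (fst r) (holds r)"
    by (rule fdef_succ_eq_tests[of _ "{}" _ N]) (use invariantD[OF assms(2)] in auto)
  with assms(1) show ?thesis by (simp add: span_def definable_iff)
qed

text \<open>The successor of a point is the first point after it in the cyclic order: every third
  point comes later. If \<open>e 1\<close> is not \<open>e 0 + 1\<close>, then
  \<open>e 0 + 1\<close> is a counterexample.\<close>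

lemma C_defines_succ: "succ_rel \<in> span C_rel"
proof -
  let ?\<phi> = "Conj (Neg (Eq 0 1)) (Neg (Ex 2 (Conj (Neg (Eq 2 0)) (Conj (Neg (Eq 2 1)) (Neg (Atom C_rel [0, 1, 2]))))))"
  have "sat e ?\<phi> \<longleftrightarrow> e 1 = e 0 + 1" for e
  proof -
    have "sat e ?\<phi> \<longleftrightarrow> e 0 \<noteq> e 1 \<and> (\<forall>a. a = e 0 \<or> a = e 1 \<or> cyc (e 0) (e 1) a)"
      by (auto simp: C_rel_iff)
    also have "\<dots> \<longleftrightarrow> e 1 = e 0 + 1"
    proof
      assume h: "e 0 \<noteq> e 1 \<and> (\<forall>a. a = e 0 \<or> a = e 1 \<or> cyc (e 0) (e 1) a)"
      show "e 1 = e 0 + 1"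
        using h[THEN conjunct2, rule_format, of "e 0 + 1"] h[THEN conjunct2, rule_format, of "e 0 - 1"] h
        by (auto simp: cyc_def)
    qed (auto simp: cyc_def)
    finally show ?thesis .
  qed
  moreover have "over {C_rel} ?\<phi>" "fv ?\<phi> \<subseteq> {..<2}" by (auto simp: fst_rels)
  ultimately have "fdef {C_rel} 2 (holds succ_rel)"
    unfolding fdef_def holds_rels by blast
  then show ?thesis by (simp add: span_def definable_iff wf_rels fst_rels)
qed

text \<open>Cutting a cyclic order at \<open>b\<close> gives a linear order on the points not below
  \<open>b\<close>. On one side of the cut \<open>b'\<close>, the cyclic order determines
  \<open><\<close> in the same way.\<close>

lemma cyc_less_iff:
  assumes "b \<le> x" "b \<le> y" "x = y \<longleftrightarrow> x' = y'" "x = b \<longleftrightarrow> x' = b'" "y = b \<longleftrightarrow> y' = b'"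
    and "x' < b' \<longleftrightarrow> y' < b'" "cyc b x y = cyc b' x' y'" "cyc b y x = cyc b' y' x'"
  shows "y' < x' \<longleftrightarrow> y < x"
proof -
  consider "x = b" | "y = b" | "x = y" | "b < x" "b < y" "x \<noteq> y" using assms by linarith
  then show ?thesis
  proof cases
    case 1
    then show ?thesis using assms(2,4,6) by auto
  next
    case 2
    then show ?thesis using assms(1,4,5,6) by (metis order.order_iff_strict not_less_iff_gr_or_eq)
  next
    case 3
    then show ?thesis using assms(3) by auto
  next
    case 4
    have "cyc b x y \<longleftrightarrow> x < y" using 4 by (auto simp: cyc_def)
    moreover have "cyc b' x' y' \<longleftrightarrow> x' < y'"
      using 4 assms(3-6) by (cases "x' < b'") (auto simp: cyc_def)
    ultimately have "x < y \<longleftrightarrow> x' < y'" using assms(7) by simp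
    then show ?thesis using assms(3) 4 by auto
  qed
qed

text \<open>The cyclic order of all triples and the near differences determine a tuple up to
  \<open>cyc_eq\<close>, so these are the finitely many tests.\<close>

lemma mem_span_C:
  assumes "wf_rel r" "invariant cyc_eq N r" "0 \<le> N" shows "r \<in> span C_rel"
proof -
  let ?n = "fst r"
  define F where "F = (\<lambda>(i, j, k) (e :: nat \<Rightarrow> int). cyc (e i) (e j) (e k)) ` ({..<?n} \<times> {..<?n} \<times> {..<?n})"
  have "fdef (span C_rel) ?n (holds r)"
  proof (rule fdef_succ_eq_tests[OF C_defines_succ, where F = F and N = N])
    show "finite F" by (simp add: F_def)
    show "fdef (span C_rel) ?n P" if P: "P \<in> F" for P
    proof -
      obtain i j k where ijk: "i < ?n" "j < ?n" "k < ?n" "P = (\<lambda>e. cyc (e i) (e j) (e k))"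
        using P by (auto simp: F_def)
      have "fdef (span C_rel) ?n (\<lambda>e. map e [i, j, k] \<in> snd C_rel)"
        by (rule fdef_atom) (use ijk in \<open>auto simp: fst_rels in_span wf_rels\<close>)
      then show ?thesis using ijk by (simp add: C_rel_iff)
    qed
    fix e e' assume E: "succ_eq N {..<?n} e e'" and F: "\<forall>P\<in>F. P e = P e'"
    have cyc: "cyc (e i) (e j) (e k) \<longleftrightarrow> cyc (e' i) (e' j) (e' k)"
      if "i < ?n" "j < ?n" "k < ?n" for i j k
    proof -
      have "(i, j, k) \<in> {..<?n} \<times> {..<?n} \<times> {..<?n}" using that by auto
      then have "(\<lambda>(i, j, k) (e :: nat \<Rightarrow> int). cyc (e i) (e j) (e k)) (i, j, k) \<in> F"
        unfolding F_def by (rule imageI)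
      then have "(\<lambda>e :: nat \<Rightarrow> int. cyc (e i) (e j) (e k)) \<in> F" by simp
      from bspec[OF F this] show ?thesis .
    qed
    have "cyc_eq N {..<?n} e' e"
    proof (cases "?n = 0")
      case True
      then show ?thesis by (auto simp: cyc_eq_def rot_eq_def lt_eq_def)
    next
      case False
      then obtain b where b: "b < ?n" and min: "\<And>i. i < ?n \<Longrightarrow> e b \<le> e i"
        using finite_minimizer[of "{..<?n}" e] by auto
      \<comment> \<open>The coordinate \<open>b\<close> is lowest in \<open>e\<close>, so
        \<open>e\<close> is the cyclic order cut at \<open>b\<close>. Moving what lies below
        \<open>e' b\<close> to the top cuts \<open>e'\<close> at the same place.\<close>
      define J where "J = {i. i < ?n \<and> e' i < e' b}"
      have near: "trunc_eq N (e' i - e' j) (e i - e j)"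
        if "i < ?n" "j < ?n" "e' j < e' i \<longleftrightarrow> e j < e i" for i j
        using succ_eqD[OF E, of i j] that unfolding trunc_eq_def by fastforce
      have same: "e' j < e' i \<longleftrightarrow> e j < e i" if "i < ?n" "j < ?n" "i \<in> J \<longleftrightarrow> j \<in> J" for i j
      proof -
        have "e i = e j \<longleftrightarrow> e' i = e' j" "e i = e b \<longleftrightarrow> e' i = e' b" "e j = e b \<longleftrightarrow> e' j = e' b"
          using succ_eqD[OF E, of i j] succ_eqD[OF E, of i b] succ_eqD[OF E, of j b] that b assms(3)
          by auto
        moreover have "e b \<le> e i" "e b \<le> e j" using min that by auto
        moreover have "(e' i < e' b) = (e' j < e' b)" using that by (auto simp: J_def)
        ultimately show ?thesis
          using cyc_less_iff cyc[OF b that(1,2)] cyc[OF b that(2,1)] by blast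
      qed
      have "rot_eq J N {..<?n} e' e" unfolding rot_eq_def
      proof (intro conjI ballI)
        show "J \<subseteq> {..<?n}" by (auto simp: J_def)
        show "lt_eq N J e' e" "lt_eq N ({..<?n} - J) e' e"
          unfolding lt_eq_def using near same by (auto simp: J_def)
        fix i j assume "i \<in> J" "j \<in> {..<?n} - J"
        then have ij: "i < ?n" "j < ?n" "e' i < e' b" "e' b \<le> e' j" by (auto simp: J_def)
        \<comment> \<open>A short distance would be copied to \<open>e\<close> and put
          \<open>e i\<close> below the minimum \<open>e b\<close>.\<close>
        have far: "N < e' b - e' i"
          using succ_eqD[OF E, of b i] min[OF ij(1)] ij b by fastforce
        with ij show "e' i + N < e' j" by simp
        have "e j = e b \<longleftrightarrow> e' j = e' b"
          using succ_eqD[OF E, of j b] ij b assms(3) by auto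
        moreover have "e b \<le> e j" "e b \<le> e i" using min ij by auto
        moreover have "e b \<noteq> e i" using succ_eqD[OF E, of b i] ij b assms(3) by auto
        ultimately have "e j < e i" using cyc[OF ij(1) b ij(2)] ij unfolding cyc_def
          by linarith
        moreover have "N < \<bar>e i - e j\<bar>" using succ_eqD[OF E, of i j] ij far by fastforce
        ultimately show "e j + N < e i" by simp
      qed
      then show ?thesis by (auto simp: cyc_eq_def)
    qed
    then show "holds r e = holds r e'" using invariantD[OF assms(2)] by metis
  qed
  then show ?thesis using fdef_in_dspace[OF dspace_span assms(1)] by blast
qed

text \<open>If moving a block \<open>J\<close> of a tuple from below the rest to above it changes the truth value, then
  gluing \<open>J\<close> to \<open>b\<close> and the rest to \<open>a\<close> decides whether \<open>b\<close> lies far above \<open>a\<close>.\<close>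
lemma lt_mem_of_not_cyc_invariant:
  assumes V: "dspace V" "succ_rel \<in> V" "r \<in> V"
    and N: "0 \<le> N" "invariant lt_eq N r" "\<not> invariant cyc_eq N r"
  shows "lt_rel \<in> V"
proof -
  let ?A = "{..<fst r}"
  obtain x x' J where J: "rot_eq J N ?A x x'" and ne: "holds r x \<noteq> holds r x'"
    using N(3) by (auto simp: invariant_def cyc_eq_def)
  obtain L where L: "0 \<le> L" "\<And>i. i \<in> ?A \<Longrightarrow> \<bar>x i\<bar> \<le> L"
    using finite_bound[of ?A x] by blast
  have JA: "J \<subseteq> ?A" using J by (simp add: rot_eq_def)
  \<comment> \<open>A lift by \<open>T\<close> takes the lowest point of \<open>J\<close> more than
    \<open>N\<close> above the highest remaining point.\<close>
  define T where "T = 2 * L + N + 1"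
  define w where "w e i = e (if i \<in> J then 1 else 0) + x i" for e :: "nat \<Rightarrow> int" and i :: nat
  have low: "holds r (w e) = holds r x" if "e 1 \<le> e 0" for e
  proof (rule invariantD[OF N(2)])
    show "lt_eq N ?A (w e) x" unfolding lt_eq_def
    proof (intro ballI)
      fix i j assume ij: "i \<in> ?A" "j \<in> ?A"
      have "x i + N < x j" if "i \<in> J" "j \<notin> J" using J ij that by (auto simp: rot_eq_def)
      moreover have "x j + N < x i" if "j \<in> J" "i \<notin> J" using J ij that by (auto simp: rot_eq_def)
      ultimately show "trunc_eq N (w e i - w e j) (x i - x j)"
        using that by (cases "i \<in> J"; cases "j \<in> J") (auto simp: w_def trunc_eq_def)
    qed
  qed
  have high: "holds r (w e) = holds r x'" if "e 1 \<ge> e 0 + T" for e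
  proof -
    have "lt_eq N ?A (\<lambda>i. if i \<in> J then x i + (e 1 - e 0) else x i) x'"
    proof (rule shift_of_rot_eq[OF J])
      fix i j assume "i \<in> J" "j \<in> ?A - J"
      then show "x j + N < x i + (e 1 - e 0)"
        using L(2)[of i] L(2)[of j] JA that by (auto simp: T_def)
    qed
    moreover have "w e = (\<lambda>i. e 0 + (if i \<in> J then x i + (e 1 - e 0) else x i))"
      by (auto simp: w_def)
    ultimately have "lt_eq N ?A (w e) x'"
      using lt_eq_trans[OF lt_eq_translate _ N(1)] by simp
    then show ?thesis using invariantD[OF N(2)] by blast
  qed
  have "fdef V 2 (holds lt_rel)"
  proof (rule fdef_succ_eq_tests[OF V(2), where F = "{\<lambda>e. holds r (w e)}" and N = T])
    have "fdef V 2 (\<lambda>e. holds r (\<lambda>i. e (if i \<in> J then 1 else 0) + x i))"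
      by (rule fdef_shift[OF V(2,3)]) auto
    then show "fdef V 2 P" if "P \<in> {\<lambda>e. holds r (w e)}" for P
      using that by (simp add: w_def[abs_def])
    fix e e' assume E: "succ_eq T {..<2} e e'" and W: "\<forall>P\<in>{\<lambda>e. holds r (w e)}. P e = P e'"
    show "holds lt_rel e = holds lt_rel e'"
    \<comment> \<open>At distance up to \<open>T\<close> the successor decides the order; beyond
      \<open>T\<close>, the value of \<open>r\<close> at \<open>w\<close> does.\<close>
    proof (cases "\<bar>e 1 - e 0\<bar> \<le> T \<or> \<bar>e' 1 - e' 0\<bar> \<le> T")
      case True
      with succ_eqD[OF E, of 1 0] have "e 1 - e 0 = e' 1 - e' 0" by simp
      then show ?thesis unfolding holds_rels by linarith
    next
      case False
      with W ne low[of e] low[of e'] high[of e] high[of e'] show ?thesis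
        unfolding holds_rels by (cases "e 0 < e 1"; cases "e' 0 < e' 1") auto
    qed
  qed simp
  with fdef_in_dspace[OF V(1) wf_rels(1)] show ?thesis by (simp add: fst_rels)
qed

text \<open>An edge stored in variables \<open>0\<close> and \<open>1\<close> serves as a unit
  vector: codirection can walk \<open>d\<close> steps along it, forwards or backwards, without
  knowing whether it points up or down.\<close>

lemma fdef_directed:
  assumes "A11_rel \<in> V"
  shows "2 \<le> n \<Longrightarrow> j < n \<Longrightarrow> fdef V n (\<lambda>e. \<bar>e 0 - e 1\<bar> = 1 \<and> e j = e 0 + (e 1 - e 0) * d)"
proof (induction d arbitrary: n j rule: int_induct[of _ 0])
  case base
  \<comment> \<open>A pair is codirected with itself exactly if it is an edge.\<close>
  then have "fdef V n (\<lambda>e. map e [0, 1, 0, 1] \<in> snd A11_rel \<and> e j = e 0)"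
    by (intro fdef_conj fdef_atom fdef_eq assms) (auto simp: fst_rels)
  then show ?case by (simp add: snd_rels)
next
  case (step1 d)
  let ?P = "\<lambda>e. (\<bar>e 0 - e 1\<bar> = 1 \<and> e n = e 0 + (e 1 - e 0) * d) \<and> map e [n, j, 0, 1] \<in> snd A11_rel"
  have "fdef V n (\<lambda>e. \<exists>a. ?P (e(n := a)))"
  proof (rule fdef_ex[OF fdef_conj])
    show "fdef V (Suc n) (\<lambda>e. \<bar>e 0 - e 1\<bar> = 1 \<and> e n = e 0 + (e 1 - e 0) * d)"
      using step1 by simp
    show "fdef V (Suc n) (\<lambda>e. map e [n, j, 0, 1] \<in> snd A11_rel)"
      using step1 assms by (intro fdef_atom) (auto simp: fst_rels)
  qed
  then show ?case
  proof (rule fdef_cong[rotated])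
    fix e :: "nat \<Rightarrow> int"
    define u where "u = (e 1 - e 0) * d"
    have "?P (e(n := a)) \<longleftrightarrow> \<bar>e 0 - e 1\<bar> = 1 \<and> a = e 0 + u \<and> a - e j = e 0 - e 1" for a
      using step1(3,4) by (auto simp: snd_rels u_def)
    then show "(\<exists>a. ?P (e(n := a))) \<longleftrightarrow> \<bar>e 0 - e 1\<bar> = 1 \<and> e j = e 0 + (e 1 - e 0) * (d + 1)"
      unfolding distrib_left u_def[symmetric] by auto
  qed
next
  case (step2 d)
  let ?P = "\<lambda>e. (\<bar>e 0 - e 1\<bar> = 1 \<and> e n = e 0 + (e 1 - e 0) * d) \<and> map e [j, n, 0, 1] \<in> snd A11_rel"
  have "fdef V n (\<lambda>e. \<exists>a. ?P (e(n := a)))"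
  proof (rule fdef_ex[OF fdef_conj])
    show "fdef V (Suc n) (\<lambda>e. \<bar>e 0 - e 1\<bar> = 1 \<and> e n = e 0 + (e 1 - e 0) * d)"
      using step2 by simp
    show "fdef V (Suc n) (\<lambda>e. map e [j, n, 0, 1] \<in> snd A11_rel)"
      using step2 assms by (intro fdef_atom) (auto simp: fst_rels)
  qed
  then show ?case
  proof (rule fdef_cong[rotated])
    fix e :: "nat \<Rightarrow> int"
    define u where "u = (e 1 - e 0) * d"
    have "?P (e(n := a)) \<longleftrightarrow> \<bar>e 0 - e 1\<bar> = 1 \<and> a = e 0 + u \<and> e j - a = e 0 - e 1" for a
      using step2(3,4) by (auto simp: snd_rels u_def)
    then show "(\<exists>a. ?P (e(n := a))) \<longleftrightarrow> \<bar>e 0 - e 1\<bar> = 1 \<and> e j = e 0 + (e 1 - e 0) * (d - 1)"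
      unfolding right_diff_distrib u_def[symmetric] by auto
  qed
qed

text \<open>A tuple distinguished from its mirror image, laid out from \<open>p\<close> in the direction of an edge
  \<open>(p, q)\<close>, tells whether \<open>q\<close> is \<open>p + 1\<close> or \<open>p - 1\<close>.\<close>
lemma succ_mem_of_not_refl_inv:
  assumes V: "dspace V" "A11_rel \<in> V" "r \<in> V"
    and inv: "invariant lt_eq N r" "\<not> refl_inv r"
  shows "succ_rel \<in> V"
proof -
  obtain f where f: "holds r f" "\<not> holds r (\<lambda>i. - f i)"
  proof -
    obtain f where "holds r (\<lambda>i. - f i) \<noteq> holds r f" using inv(2) by (auto simp: refl_inv_def)
    then show ?thesis using that[of f] that[of "\<lambda>i. - f i"] by auto
  qed
  let ?G = "\<lambda>e :: nat \<Rightarrow> int. \<bar>e 0 - e 1\<bar> = 1"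
  have G: "fdef V 2 ?G"
  proof -
    have "fdef V 2 (\<lambda>e. map e [0, 1, 0, 1] \<in> snd A11_rel)"
      by (intro fdef_atom V) (auto simp: fst_rels)
    then show ?thesis by (simp add: snd_rels)
  qed
  have "fdef V 2 (\<lambda>e. ?G e \<and> holds r (\<lambda>i. (\<lambda>i e. e 0 + (e 1 - e 0) * f i) i e))"
    by (rule fdef_subst[OF V(3) G]) (use fdef_directed[OF V(2)] in auto)
  then have "fdef V 2 (holds succ_rel)"
  proof (rule fdef_cong[rotated])
    fix e :: "nat \<Rightarrow> int"
    have "holds r (\<lambda>i. e 0 + g i) = holds r g" for g
      by (rule invariantD[OF inv(1) lt_eq_translate])
    from this[of f] this[of "\<lambda>i. - f i"] f
    have *: "holds r (\<lambda>i. e 0 + f i)" "\<not> holds r (\<lambda>i. e 0 + - f i)" by auto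
    show "(?G e \<and> holds r (\<lambda>i. (\<lambda>i e. e 0 + (e 1 - e 0) * f i) i e)) = holds succ_rel e"
    proof (cases "?G e")
      case True
      then consider "e 1 - e 0 = 1" | "e 1 - e 0 = - 1" by linarith
      then show ?thesis using * by cases (auto simp: holds_rels)
    qed (auto simp: holds_rels)
  qed
  with fdef_in_dspace[OF V(1) wf_rels(2)] show ?thesis by (simp add: fst_rels)
qed

section \<open>Rearranging clusters\<close>

text \<open>Bubble sort: exchanging the values of an adjacent inverted pair removes that inversion
  and creates none, so \<open>p\<close> reaches the order type of \<open>q\<close>.\<close>

lemma adjacent_transpositions_connect:
  fixes p q :: "'a \<Rightarrow> int" and g :: "('a \<Rightarrow> int) \<Rightarrow> 'b"
  assumes C: "finite C" and p: "inj_on p C" and q: "inj_on q C"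
    and ord: "\<And>p. inj_on p C \<Longrightarrow> (\<And>c d. c \<in> C \<Longrightarrow> d \<in> C \<Longrightarrow> p c < p d \<longleftrightarrow> q c < q d) \<Longrightarrow> g p = g q"
    and swap: "\<And>p a b. inj_on p C \<Longrightarrow> a \<in> C \<Longrightarrow> b \<in> C \<Longrightarrow> p a < p b \<Longrightarrow>
      (\<And>c. c \<in> C \<Longrightarrow> \<not> (p a < p c \<and> p c < p b)) \<Longrightarrow> g (p(a := p b, b := p a)) = g p"
  shows "g p = g q"
  using p
proof (induction "card {(c, d). c \<in> C \<and> d \<in> C \<and> p c < p d \<and> q d < q c}" arbitrary: p rule: less_induct)
  case less
  define Inv where "Inv p = {(c, d). c \<in> C \<and> d \<in> C \<and> p c < p d \<and> q d < q c}" for p :: "'a \<Rightarrow> int"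
  have fin: "finite (Inv p)" for p
    by (rule finite_subset[of _ "C \<times> C"]) (auto simp: Inv_def C)
  show ?case
  proof (cases "Inv p = {}")
    case True
    show ?thesis
    proof (rule ord[OF less.prems])
      fix c d assume "c \<in> C" "d \<in> C"
      moreover from this have "p c = p d \<longleftrightarrow> q c = q d"
        using less.prems q by (auto dest: inj_onD)
      moreover have "(c, d) \<notin> Inv p" "(d, c) \<notin> Inv p" using True by auto
      ultimately show "p c < p d \<longleftrightarrow> q c < q d" unfolding Inv_def by auto
    qed
  next
    case False
    \<comment> \<open>An inversion of least gap is adjacent: a value in between would form a shorter
      inversion with \<open>a\<close> or with \<open>b\<close>.\<close>
    then obtain ab where ab': "ab \<in> Inv p"
      "\<And>x. x \<in> Inv p \<Longrightarrow> p (snd ab) - p (fst ab) \<le> p (snd x) - p (fst x)"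
      using finite_minimizer[OF fin False, of "\<lambda>x. p (snd x) - p (fst x)"] by blast
    obtain a b where "ab = (a, b)" by (cases ab)
    with ab' have ab: "(a, b) \<in> Inv p"
      and min: "\<And>c d. (c, d) \<in> Inv p \<Longrightarrow> p b - p a \<le> p d - p c" by fastforce+
    have abC: "a \<in> C" "b \<in> C" "p a < p b" "q b < q a" using ab by (auto simp: Inv_def)
    have adj: "\<not> (p a < p c \<and> p c < p b)" if "c \<in> C" for c
    proof
      assume c: "p a < p c \<and> p c < p b"
      have "(a, c) \<in> Inv p \<or> (c, b) \<in> Inv p" using abC c that by (auto simp: Inv_def)
      then show False using min[of a c] min[of c b] c by auto
    qed
    define p' where "p' = p(a := p b, b := p a)"
    have "a \<noteq> b" using abC by auto
    have inj': "inj_on p' C"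
    proof (rule inj_onI)
      fix c d assume "c \<in> C" "d \<in> C" "p' c = p' d"
      then show "c = d" using less.prems abC \<open>a \<noteq> b\<close> unfolding p'_def
        by (auto split: if_splits dest: inj_onD)
    qed
    have "Inv p' \<subseteq> Inv p - {(a, b)}"
    proof
      fix x assume "x \<in> Inv p'"
      then obtain c d where x: "x = (c, d)" and cd: "c \<in> C" "d \<in> C" "p' c < p' d" "q d < q c"
        by (auto simp: Inv_def)
      have "p c < p d"
      proof -
        have "p c \<noteq> p a \<or> c = a" "p c \<noteq> p b \<or> c = b" "p d \<noteq> p a \<or> d = a" "p d \<noteq> p b \<or> d = b"
          using less.prems abC cd(1,2) by (auto dest: inj_onD)
        then show ?thesis
          using cd(3,4) abC(3,4) adj[OF cd(1)] adj[OF cd(2)] \<open>a \<noteq> b\<close> unfolding p'_def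
          by (auto split: if_splits)
      qed
      moreover have "(c, d) \<noteq> (a, b)" using cd(3) abC(3) \<open>a \<noteq> b\<close> by (auto simp: p'_def)
      ultimately show "x \<in> Inv p - {(a, b)}" using x cd by (auto simp: Inv_def)
    qed
    then have "Inv p' \<subset> Inv p" using ab by blast
    then have "card (Inv p') < card (Inv p)" using fin psubset_card_mono by blast
    then have "g p' = g q"
      using less.hyps[of p'] inj' by (simp add: Inv_def)
    moreover have "g p' = g p" unfolding p'_def
      by (rule swap[OF less.prems abC(1,2,3) adj])
    ultimately show ?thesis by simp
  qed
qed

lemma lt_eq_blocks:
  assumes "0 \<le> N"
    and "\<And>i j. i \<in> S \<Longrightarrow> j \<in> S \<Longrightarrow> \<kappa> i = (\<kappa> j :: nat) \<Longrightarrow> w i - w j = z i - z j"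
    and "\<And>i j. i \<in> S \<Longrightarrow> j \<in> S \<Longrightarrow> \<kappa> i < \<kappa> j \<Longrightarrow> w i + N < w j \<and> z i + N < z j"
  shows "lt_eq N S w z"
  unfolding lt_eq_def
proof (intro ballI)
  fix i j assume ij: "i \<in> S" "j \<in> S"
  consider "\<kappa> i = \<kappa> j" | "\<kappa> i < \<kappa> j" | "\<kappa> j < \<kappa> i" by linarith
  then show "trunc_eq N (w i - w j) (z i - z j)"
    using assms(2)[OF ij] assms(3)[OF ij] assms(3)[OF ij(2,1)]
    by cases (auto simp: trunc_eq_def)
qed

text \<open>The variable to which a block is glued. Cyclically, block \<open>3\<close> is followed
  by block \<open>0\<close>, so the two share a variable and three variables carry four
  blocks.\<close>

definition home :: "nat \<Rightarrow> nat" where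
  "home k = (if k = 3 then 0 else k)"

text \<open>In \<open>z\<close> the blocks \<open>0, 1, 2, 3\<close> are in increasing order; in \<open>w\<close> the block \<open>3\<close> has been moved just
  below the block \<open>0\<close>, and the three groups \<open>{3, 0}, {1}, {2}\<close> are in this cyclic order.\<close>
lemma cyc_eq_blocks:
  fixes \<kappa> :: "nat \<Rightarrow> nat"
  assumes N: "0 \<le> N" and \<kappa>: "\<And>i. i \<in> A \<Longrightarrow> \<kappa> i \<le> 3"
    and z: "\<And>i j. i \<in> A \<Longrightarrow> j \<in> A \<Longrightarrow> \<kappa> i < \<kappa> j \<Longrightarrow> z i + N < z j"
    and same: "\<And>i j. i \<in> A \<Longrightarrow> j \<in> A \<Longrightarrow> \<kappa> i = \<kappa> j \<Longrightarrow> w i - w j = z i - z j"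
    and low: "\<And>i j. i \<in> A \<Longrightarrow> j \<in> A \<Longrightarrow> \<kappa> i = 3 \<Longrightarrow> \<kappa> j = 0 \<Longrightarrow> w i + N < w j"
    and far: "\<And>i j. i \<in> A \<Longrightarrow> j \<in> A \<Longrightarrow> e (home (\<kappa> i)) < e (home (\<kappa> j)) \<Longrightarrow> w i + N < w j"
    and cyc: "cyc (e 0) (e 1) (e (2 :: nat))"
  shows "cyc_eq N A w z"
proof -
  \<comment> \<open>\<open>P\<close> selects the blocks that move from the bottom of
    \<open>w\<close> to the top. The order of \<open>w\<close> is 3,0,1,2 or 1,2,3,0 or 2,3,0,1 in
    the three cases below, so the moved blocks are 3, or 1,2,3, or 2,3.\<close>
  have rot: "cyc_eq N A w z"
    if J: "J = {i \<in> A. P (\<kappa> i)}"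
      and *: "\<And>i j. i \<in> A \<Longrightarrow> j \<in> A \<Longrightarrow> \<kappa> i < \<kappa> j \<Longrightarrow> P (\<kappa> i) = P (\<kappa> j) \<Longrightarrow> w i + N < w j"
      and **: "\<And>i j. i \<in> A \<Longrightarrow> j \<in> A \<Longrightarrow> P (\<kappa> i) \<Longrightarrow> \<not> P (\<kappa> j) \<Longrightarrow> w i + N < w j \<and> \<kappa> j < \<kappa> i"
    for P J
  proof -
    have "rot_eq J N A w z" unfolding rot_eq_def
    proof (intro conjI ballI)
      show "J \<subseteq> A" by (auto simp: J)
      show "lt_eq N J w z" "lt_eq N (A - J) w z"
        by (rule lt_eq_blocks[OF N, of _ \<kappa>]; use same z * in \<open>force simp: J\<close>)+
      fix i j assume "i \<in> J" "j \<in> A - J"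
      then have "i \<in> A" "j \<in> A" "P (\<kappa> i)" "\<not> P (\<kappa> j)" by (auto simp: J)
      then show "w i + N < w j" "z j + N < z i" using ** z by blast+
    qed
    then show ?thesis by (auto simp: cyc_eq_def)
  qed
  have vals: "\<kappa> i = 0 \<or> \<kappa> i = 1 \<or> \<kappa> i = 2 \<or> \<kappa> i = 3" if "i \<in> A" for i
    using \<kappa>[OF that] by linarith
  from cyc consider (012) "e 0 < e 1" "e 1 < e 2" | (120) "e 1 < e 2" "e 2 < e 0" | (201) "e 2 < e 0" "e 0 < e 1"
    unfolding cyc_def by blast
  then show ?thesis
  proof cases
    case 012
    show ?thesis
    proof (rule rot[OF refl, of "\<lambda>k. k = 3"])
      fix i j assume ij: "i \<in> A" "j \<in> A"
      show "w i + N < w j" if "\<kappa> i < \<kappa> j" "(\<kappa> i = 3) = (\<kappa> j = 3)"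
        using vals[OF ij(1)] vals[OF ij(2)] that 012 far[OF ij] by (auto simp: home_def)
      show "w i + N < w j \<and> \<kappa> j < \<kappa> i" if "\<kappa> i = 3" "\<not> \<kappa> j = 3"
        using vals[OF ij(2)] that 012 far[OF ij] low[OF ij] by (auto simp: home_def)
    qed
  next
    case 120
    show ?thesis
    proof (rule rot[OF refl, of "\<lambda>k. k \<noteq> 0"])
      fix i j assume ij: "i \<in> A" "j \<in> A"
      show "w i + N < w j" if "\<kappa> i < \<kappa> j" "(\<kappa> i \<noteq> 0) = (\<kappa> j \<noteq> 0)"
        using vals[OF ij(1)] vals[OF ij(2)] that 120 far[OF ij] by (auto simp: home_def)
      show "w i + N < w j \<and> \<kappa> j < \<kappa> i" if "\<kappa> i \<noteq> 0" "\<not> \<kappa> j \<noteq> 0"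
        using vals[OF ij(1)] that 120 far[OF ij] low[OF ij] by (auto simp: home_def)
    qed
  next
    case 201
    show ?thesis
    proof (rule rot[OF refl, of "\<lambda>k. k = 2 \<or> k = 3"])
      fix i j assume ij: "i \<in> A" "j \<in> A"
      show "w i + N < w j" if "\<kappa> i < \<kappa> j" "(\<kappa> i = 2 \<or> \<kappa> i = 3) = (\<kappa> j = 2 \<or> \<kappa> j = 3)"
        using vals[OF ij(1)] vals[OF ij(2)] that 201 far[OF ij] by (auto simp: home_def)
      show "w i + N < w j \<and> \<kappa> j < \<kappa> i" if "\<kappa> i = 2 \<or> \<kappa> i = 3" "\<not> (\<kappa> j = 2 \<or> \<kappa> j = 3)"
        using vals[OF ij(2)] that 201 far[OF ij] low[OF ij] by (auto simp: home_def)
    qed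
  qed
qed

lemma cyc_rotate: "cyc a b c \<longleftrightarrow> cyc b c a"
  by (auto simp: cyc_def)

text \<open>If \<open>a\<close> and \<open>b\<close> are close, then \<open>c\<close> is either
  rigidly tied to them or outside the interval between them; in the latter case
  \<open>cyc a b c\<close> just means \<open>a < b\<close>, on whichever side \<open>c\<close>
  lies.\<close>

lemma cyc_near:
  assumes "\<bar>a - b\<bar> \<le> M" "a - b = a' - b'"
    and "\<bar>a - c\<bar> \<le> M \<or> \<bar>a' - c'\<bar> \<le> M \<Longrightarrow> a - c = a' - c'"
    and "\<bar>b - c\<bar> \<le> M \<or> \<bar>b' - c'\<bar> \<le> M \<Longrightarrow> b - c = b' - c'"
  shows "cyc a b c = cyc a' b' c'"
proof (cases "a - c = a' - c'")
  case True
  with assms(2) have "a < b \<longleftrightarrow> a' < b'" "b < c \<longleftrightarrow> b' < c'" "c < a \<longleftrightarrow> c' < a'" by auto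
  then show ?thesis by (simp add: cyc_def)
next
  case False
  moreover from this have "b - c \<noteq> b' - c'" using assms(2) by linarith
  ultimately have "\<bar>a - c\<bar> > M" "\<bar>a' - c'\<bar> > M" "\<bar>b - c\<bar> > M" "\<bar>b' - c'\<bar> > M"
    using assms(3,4) by (meson not_le)+
  then have "cyc a b c \<longleftrightarrow> a < b" "cyc a' b' c' \<longleftrightarrow> a' < b'"
    using assms(1,2) by (auto simp: cyc_def)
  then show ?thesis using assms(2) by auto
qed

text \<open>The blocks \<open>1\<close> and \<open>2\<close> are neighbours, and their exchange is
  visible to \<open>r\<close>. Gluing block \<open>1\<close>, block \<open>2\<close> and the union
  of \<open>3\<close> and \<open>0\<close> to three variables makes \<open>r\<close> test the
  orientation of a widely spread triple.\<close>

lemma C_mem_of_block_swap: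
  fixes \<kappa> :: "nat \<Rightarrow> nat"
  defines "flip \<equiv> \<lambda>k :: nat. if k = 1 then 2 else if k = 2 then 1 else k"
  assumes V: "dspace V" "succ_rel \<in> V" "r \<in> V"
    and N: "0 \<le> N" "invariant cyc_eq N r"
    and \<kappa>: "\<And>i. i < fst r \<Longrightarrow> \<kappa> i \<le> 3"
    and z: "\<And>i j. i < fst r \<Longrightarrow> j < fst r \<Longrightarrow> \<kappa> i < \<kappa> j \<Longrightarrow> z i + N < z j"
    and z': "\<And>i j. i < fst r \<Longrightarrow> j < fst r \<Longrightarrow> flip (\<kappa> i) < flip (\<kappa> j) \<Longrightarrow> z' i + N < z' j"
    and same: "\<And>i j. i < fst r \<Longrightarrow> j < fst r \<Longrightarrow> \<kappa> i = \<kappa> j \<Longrightarrow> z i - z j = z' i - z' j"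
    and ne: "holds r z \<noteq> holds r z'"
  shows "C_rel \<in> V"
proof -
  let ?A = "{..<fst r}"
  obtain L where L: "0 \<le> L" "\<And>i. i \<in> ?A \<Longrightarrow> \<bar>z i\<bar> \<le> L"
    using finite_bound[of ?A z] by blast
  \<comment> \<open>Lowering block \<open>3\<close> by \<open>T\<close> puts it more than
    \<open>N\<close> below block \<open>0\<close>.\<close>
  define T where "T = 2 * L + N + 1"
  \<comment> \<open>Offsets are at most \<open>L + T\<close>, so variables more than
    \<open>M\<close> apart keep their blocks more than \<open>N\<close> apart.\<close>
  define M where "M = 2 * (L + T) + N + 1"
  define x where "x i = (if \<kappa> i = 3 then z i - T else z i)" for i
  define w where "w e i = e (home (\<kappa> i)) + x i" for e :: "nat \<Rightarrow> int" and i
  have x: "\<bar>x i\<bar> \<le> L + T" if "i \<in> ?A" for i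
    using L(2)[OF that] N(1) L(1) by (auto simp: x_def T_def)
  have low: "w e i + N < w e j" if "i \<in> ?A" "j \<in> ?A" "\<kappa> i = 3" "\<kappa> j = 0" for e i j
    using L(2)[OF that(1)] L(2)[OF that(2)] that by (auto simp: w_def x_def home_def T_def)
  have sep: "w e i + N < w e j"
    if "\<And>s t. s \<in> {0, 1, 2} \<Longrightarrow> t \<in> {0, 1, 2} \<Longrightarrow> s \<noteq> t \<Longrightarrow> \<bar>e s - e t\<bar> > M"
      and ij: "i \<in> ?A" "j \<in> ?A" "e (home (\<kappa> i)) < e (home (\<kappa> j))" for e i j
  proof -
    have "home (\<kappa> i) \<in> {0, 1, 2}" "home (\<kappa> j) \<in> {0, 1, 2}"
      using \<kappa>[of i] \<kappa>[of j] ij by (auto simp: home_def)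
    moreover have "home (\<kappa> i) \<noteq> home (\<kappa> j)" using ij(3) by auto
    ultimately have "\<bar>e (home (\<kappa> i)) - e (home (\<kappa> j))\<bar> > M" by (rule that(1))
    with ij(3) show ?thesis using x[OF ij(1)] x[OF ij(2)] by (simp add: w_def M_def)
  qed
  have pos: "holds r (w e) = holds r z"
    if d: "\<And>s t. s \<in> {0, 1, 2} \<Longrightarrow> t \<in> {0, 1, 2} \<Longrightarrow> s \<noteq> t \<Longrightarrow> \<bar>e s - e t\<bar> > M"
      and c: "cyc (e 0) (e 1) (e 2)" for e
  proof (rule invariantD[OF N(2)], rule cyc_eq_blocks[where \<kappa> = \<kappa>, OF N(1) _ _ _ _ _ c])
    show "w e i - w e j = z i - z j" if "\<kappa> i = \<kappa> j" for i j
      using that by (auto simp: w_def x_def)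
    show "w e i + N < w e j" if "i \<in> ?A" "j \<in> ?A" "e (home (\<kappa> i)) < e (home (\<kappa> j))" for i j
      by (rule sep[OF d that])
  qed (use \<kappa> z low in auto)
  \<comment> \<open>Interchanging the names \<open>1\<close> and \<open>2\<close> by
    \<open>flip\<close> turns the opposite orientation into the positive one, with \<open>z'\<close>
    as the sorted tuple.\<close>
  have neg: "holds r (w e) = holds r z'"
    if d: "\<And>s t. s \<in> {0, 1, 2} \<Longrightarrow> t \<in> {0, 1, 2} \<Longrightarrow> s \<noteq> t \<Longrightarrow> \<bar>e s - e t\<bar> > M"
      and c: "cyc (e 0) (e 2) (e 1)" for e
  proof (rule invariantD[OF N(2)])
    have flip_flip: "flip (flip k) = k" for k by (simp add: flip_def)
    have h: "(e \<circ> flip) (home (flip k)) = e (home k)" for k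
      by (auto simp: flip_def home_def)
    have c': "cyc ((e \<circ> flip) 0) ((e \<circ> flip) 1) ((e \<circ> flip) 2)"
      using c by (simp add: flip_def)
    show "cyc_eq N ?A (w e) z'"
    proof (rule cyc_eq_blocks[where \<kappa> = "\<lambda>i. flip (\<kappa> i)", OF N(1) _ _ _ _ _ c'])
      show "flip (\<kappa> i) \<le> 3" if "i \<in> ?A" for i using \<kappa>[of i] that by (auto simp: flip_def)
      show "w e i - w e j = z' i - z' j" if "i \<in> ?A" "j \<in> ?A" "flip (\<kappa> i) = flip (\<kappa> j)" for i j
      proof -
        have k: "\<kappa> i = \<kappa> j" using flip_flip that(3) by metis
        then have "w e i - w e j = z i - z j" by (simp add: w_def x_def)
        also have "\<dots> = z' i - z' j" using k that(1,2) by (intro same) auto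
        finally show ?thesis .
      qed
      show "w e i + N < w e j" if "i \<in> ?A" "j \<in> ?A" "flip (\<kappa> i) = 3" "flip (\<kappa> j) = 0" for i j
      proof (rule low[OF that(1,2)])
        show "\<kappa> i = 3" using flip_flip[of "\<kappa> i"] that(3) by (simp add: flip_def)
        show "\<kappa> j = 0" using flip_flip[of "\<kappa> j"] that(4) by (simp add: flip_def)
      qed
      show "w e i + N < w e j"
        if "i \<in> ?A" "j \<in> ?A" "(e \<circ> flip) (home (flip (\<kappa> i))) < (e \<circ> flip) (home (flip (\<kappa> j)))" for i j
        using that unfolding h by (intro sep[OF d])
    qed (use z' in auto)
  qed
  have "fdef V 3 (holds C_rel)"
  proof (rule fdef_succ_eq_tests[OF V(2), where F = "{\<lambda>e. holds r (w e)}" and N = M])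
    have "fdef V 3 (\<lambda>e. holds r (\<lambda>i. e (home (\<kappa> i)) + x i))"
    proof (rule fdef_shift[OF V(2,3)])
      show "home (\<kappa> i) < 3" if "i < fst r" for i using \<kappa>[OF that] by (auto simp: home_def)
    qed
    then show "fdef V 3 P" if "P \<in> {\<lambda>e. holds r (w e)}" for P
      using that by (simp add: w_def[abs_def])
    fix e e' assume E: "succ_eq M {..<3} e e'" and "\<forall>P\<in>{\<lambda>e. holds r (w e)}. P e = P e'"
    then have W: "holds r (w e) = holds r (w e')" by simp
    have D: "e s - e t = e' s - e' t"
      if "s < 3" "t < 3" "\<bar>e s - e t\<bar> \<le> M \<or> \<bar>e' s - e' t\<bar> \<le> M" for s t
      using succ_eqD[OF E _ _ that(3)] that by simp
    show "holds C_rel e = holds C_rel e'"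
    \<comment> \<open>With a close pair, \<open>cyc_near\<close> reduces the cyclic order to near
      differences. Otherwise \<open>pos\<close> and \<open>neg\<close> exhaust the two orientations
      and \<open>r\<close> tells them apart.\<close>
    proof (cases "\<bar>e 0 - e 1\<bar> \<le> M \<or> \<bar>e 1 - e 2\<bar> \<le> M \<or> \<bar>e 2 - e 0\<bar> \<le> M")
      case True
      consider "\<bar>e 0 - e 1\<bar> \<le> M" | "\<bar>e 1 - e 2\<bar> \<le> M" | "\<bar>e 2 - e 0\<bar> \<le> M" using True by blast
      then have "cyc (e 0) (e 1) (e 2) = cyc (e' 0) (e' 1) (e' 2)"
      proof cases
        case 1
        show ?thesis by (rule cyc_near[of _ _ M]) (use 1 D[of 0 1] D[of 0 2] D[of 1 2] in auto)
      next
        case 2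
        have "cyc (e 1) (e 2) (e 0) = cyc (e' 1) (e' 2) (e' 0)"
          by (rule cyc_near[of _ _ M]) (use 2 D[of 1 2] D[of 1 0] D[of 2 0] in auto)
        then show ?thesis using cyc_rotate by blast
      next
        case 3
        have "cyc (e 2) (e 0) (e 1) = cyc (e' 2) (e' 0) (e' 1)"
          by (rule cyc_near[of _ _ M]) (use 3 D[of 2 0] D[of 2 1] D[of 0 1] in auto)
        then show ?thesis using cyc_rotate by blast
      qed
      then show ?thesis by (simp add: holds_rels)
    next
      case False
      have d: "\<bar>e s - e t\<bar> > M" if "s \<in> {0, 1, 2}" "t \<in> {0, 1, 2}" "s \<noteq> t" for s t
        using that False by auto
      have "\<not> (\<bar>e' 0 - e' 1\<bar> \<le> M \<or> \<bar>e' 1 - e' 2\<bar> \<le> M \<or> \<bar>e' 2 - e' 0\<bar> \<le> M)"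
        using False D[of 0 1] D[of 1 2] D[of 2 0] by auto
      then have d': "\<bar>e' s - e' t\<bar> > M" if "s \<in> {0, 1, 2}" "t \<in> {0, 1, 2}" "s \<noteq> t" for s t
        using that by auto
      have "cyc (f 0) (f 1) (f 2) \<longleftrightarrow> holds r (w f) = holds r z"
        if f: "\<And>s t. s \<in> {0, 1, 2} \<Longrightarrow> t \<in> {0, 1, 2} \<Longrightarrow> s \<noteq> t \<Longrightarrow> \<bar>f s - f t\<bar> > M" for f
      proof -
        have "0 \<le> M" using L(1) N(1) by (simp add: M_def T_def)
        then have "f 0 \<noteq> f 1" "f 1 \<noteq> f 2" "f 2 \<noteq> f 0" using f[of 0 1] f[of 1 2] f[of 2 0] by auto
        then have "cyc (f 0) (f 1) (f 2) \<noteq> cyc (f 0) (f 2) (f 1)" by (auto simp: cyc_def)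
        then show ?thesis using pos[of f, OF f] neg[of f, OF f] ne by blast
      qed
      from this[of e, OF d] this[of e', OF d'] W show ?thesis by (simp add: holds_rels)
    qed
  qed simp
  with fdef_in_dspace[OF V(1) wf_rels(5)] show ?thesis by (simp add: fst_rels)
qed

text \<open>Pigeonhole: the windows between \<open>2 ^ k * N\<close> and its double are pairwise
  disjoint, and there is one more of them than \<open>S\<close> has elements.\<close>

lemma gap_scale_exists:
  fixes S :: "int set"
  assumes "finite S" "0 \<le> N"
  shows "\<exists>k\<le>card S. \<forall>s\<in>S. \<not> (2 ^ k * N < s \<and> s \<le> 2 * (2 ^ k * N))"
proof (rule ccontr)
  assume "\<not> ?thesis"
  then have "\<forall>k\<in>{..card S}. \<exists>s\<in>S. 2 ^ k * N < s \<and> s \<le> 2 * (2 ^ k * N)" by auto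
  then obtain f where f: "\<And>k. k \<le> card S \<Longrightarrow> f k \<in> S \<and> 2 ^ k * N < f k \<and> f k \<le> 2 * (2 ^ k * N)"
    by (metis atMost_iff)
  have less: "f k < f l" if "k < l" "l \<le> card S" for k l
  proof -
    have "(2 :: int) ^ Suc k \<le> 2 ^ l" using that(1) by (intro power_increasing) auto
    then have "2 ^ Suc k * N \<le> 2 ^ l * N" using assms(2) by (rule mult_right_mono)
    then show ?thesis using f[of k] f[of l] that by simp
  qed
  have "inj_on f {..card S}"
  proof (rule inj_onI)
    fix k l assume "k \<in> {..card S}" "l \<in> {..card S}" "f k = f l"
    then show "k = l" using less[of k l] less[of l k] by (cases k l rule: linorder_cases) auto
  qed
  moreover have "f ` {..card S} \<subseteq> S" using f by auto
  ultimately have "card {..card S} \<le> card S" using card_inj_on_le assms(1) by blast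
  then show False by simp
qed

text \<open>If no distance lies between \<open>K\<close> and \<open>2 * K\<close>, then being within
  \<open>K\<close> is transitive on the tuple, and its classes are the clusters. The exponent counts
  pairs of coordinates, so the bound on \<open>K\<close> does not depend on
  \<open>x\<close>.\<close>

lemma cluster_selector:
  assumes "finite A" "0 \<le> N"
  obtains K :: int and c :: "nat \<Rightarrow> nat" where "N \<le> K" "2 * K \<le> 2 * (2 ^ (card A * card A) * N)"
    "\<And>i. i \<in> A \<Longrightarrow> c i \<in> A" "\<And>i. i \<in> A \<Longrightarrow> \<bar>x i - x (c i)\<bar> \<le> K"
    "\<And>i j. i \<in> A \<Longrightarrow> j \<in> A \<Longrightarrow> c i \<noteq> c j \<Longrightarrow> 2 * K < \<bar>x i - x j :: int\<bar>"
proof -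
  define S where "S = (\<lambda>(i, j). \<bar>x i - x j\<bar>) ` (A \<times> A)"
  have S: "finite S" "card S \<le> card A * card A"
    using assms(1) card_image_le[of "A \<times> A" "\<lambda>(i, j). \<bar>x i - x j\<bar>"]
    by (auto simp: S_def card_cartesian_product)
  obtain k where k: "k \<le> card S" "\<And>s. s \<in> S \<Longrightarrow> \<not> (2 ^ k * N < s \<and> s \<le> 2 * (2 ^ k * N))"
    using gap_scale_exists[OF S(1) assms(2)] by blast
  define K where "K = 2 ^ k * N"
  have gap: "2 * K < \<bar>x i - x j\<bar>" if "i \<in> A" "j \<in> A" "K < \<bar>x i - x j\<bar>" for i j
  proof -
    have "\<bar>x i - x j\<bar> \<in> S" using that by (force simp: S_def)
    from k(2)[OF this] that(3) show ?thesis unfolding K_def by linarith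
  qed
  define c where "c i = (LEAST j. j \<in> A \<and> \<bar>x i - x j\<bar> \<le> K)" for i
  have "N \<le> K" using mult_right_mono[of 1 "2 ^ k" N] assms(2) by (simp add: K_def)
  have c: "c i \<in> A \<and> \<bar>x i - x (c i)\<bar> \<le> K" if "i \<in> A" for i
    unfolding c_def by (rule LeastI[of _ i]) (use that \<open>N \<le> K\<close> assms(2) in auto)
  show ?thesis
  proof (rule that[of K c])
    have "(2 :: int) ^ k \<le> 2 ^ (card A * card A)"
      using k(1) S(2) by (intro power_increasing) auto
    then have "K \<le> 2 ^ (card A * card A) * N"
      unfolding K_def using assms(2) by (rule mult_right_mono)
    then show "2 * K \<le> 2 * (2 ^ (card A * card A) * N)" by simp
    show "2 * K < \<bar>x i - x j\<bar>" if "i \<in> A" "j \<in> A" "c i \<noteq> c j" for i j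
    proof (rule gap[OF that(1,2)], rule ccontr)
      assume near: "\<not> K < \<bar>x i - x j\<bar>"
      \<comment> \<open>Points of one cluster have the same neighbours, hence the same least
        representative \<open>c\<close>.\<close>
      have "\<bar>x i - x l\<bar> \<le> K \<longleftrightarrow> \<bar>x j - x l\<bar> \<le> K" if l: "l \<in> A" for l
      proof
        assume "\<bar>x i - x l\<bar> \<le> K"
        then have "\<bar>x j - x l\<bar> \<le> 2 * K" using near by linarith
        then show "\<bar>x j - x l\<bar> \<le> K" using gap[OF \<open>j \<in> A\<close> l] by linarith
      next
        assume "\<bar>x j - x l\<bar> \<le> K"
        then have "\<bar>x i - x l\<bar> \<le> 2 * K" using near by linarith
        then show "\<bar>x i - x l\<bar> \<le> K" using gap[OF \<open>i \<in> A\<close> l] by linarith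
      qed
      then have "c i = c j" unfolding c_def by meson
      with that(3) show False by simp
    qed
  qed (use c \<open>N \<le> K\<close> in auto)
qed

text \<open>At a large enough bound, \<open>x\<close> and \<open>x'\<close> consist of the same
  clusters in different orders. If \<open>r\<close> tells them apart, then by bubble sort it notices
  some exchange of two neighbouring clusters.\<close>

lemma C_mem_of_not_succ_invariant:
  assumes V: "dspace V" "succ_rel \<in> V" "r \<in> V"
    and N: "0 \<le> N" "invariant cyc_eq N r" and ninv: "\<And>M. \<not> invariant succ_eq M r"
  shows "C_rel \<in> V"
proof -
  let ?A = "{..<fst r}"
  \<comment> \<open>Chosen before \<open>x\<close> and \<open>x'\<close>: twice the worst scale that
    \<open>cluster_selector\<close> can return.\<close>
  define M where "M = 2 * (2 ^ (card ?A * card ?A) * N)"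
  obtain x x' where E: "succ_eq M ?A x x'" and ne: "holds r x \<noteq> holds r x'"
    using ninv[of M] by (auto simp: invariant_def)
  obtain K c where K: "N \<le> K" "2 * K \<le> M"
    and c: "\<And>i. i \<in> ?A \<Longrightarrow> c i \<in> ?A" "\<And>i. i \<in> ?A \<Longrightarrow> \<bar>x i - x (c i)\<bar> \<le> K"
      "\<And>i j. i \<in> ?A \<Longrightarrow> j \<in> ?A \<Longrightarrow> c i \<noteq> c j \<Longrightarrow> 2 * K < \<bar>x i - x j\<bar>"
    using cluster_selector[of ?A N x] N(1) unfolding M_def by blast
  define v where "v i = x i - x (c i)" for i
  have v: "\<bar>v i\<bar> \<le> K" if "i \<in> ?A" for i using c(2)[OF that] by (simp add: v_def)
  have v': "x' i - x' (c i) = v i" if "i \<in> ?A" for i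
  proof -
    have "\<bar>x i - x (c i)\<bar> \<le> M" using c(2)[OF that] K N(1) by linarith
    then show ?thesis using succ_eqD[OF E that c(1)[OF that]] by (simp add: v_def)
  qed
  have c': "2 * K < \<bar>x' i - x' j\<bar>" if ij: "i \<in> ?A" "j \<in> ?A" "c i \<noteq> c j" for i j
  proof (rule ccontr)
    assume "\<not> ?thesis"
    then have "x i - x j = x' i - x' j" using succ_eqD[OF E ij(1,2)] K(2) by linarith
    with c(3)[OF ij] \<open>\<not> ?thesis\<close> show False by simp
  qed
  have cc: "c (c i) = c i" if "i \<in> ?A" for i
    using c(1)[OF that] c(2)[OF that] c(3)[OF that c(1)[OF that]] N(1) K(1) by fastforce
  \<comment> \<open>The tuple in which the clusters are ordered by \<open>p\<close> and keep their
    internal offsets. Offsets use up at most \<open>2 * K\<close> of the spacing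
    \<open>3 * K + 1\<close>, which leaves more than \<open>K \<ge> N\<close>.\<close>
  define z where "z p i = (3 * K + 1) * p (c i) + v i" for p :: "nat \<Rightarrow> int" and i
  have z: "z p i + N < z p j" if "i \<in> ?A" "j \<in> ?A" "p (c i) < p (c j)" for p i j
  proof -
    have "(3 * K + 1) * 1 \<le> (3 * K + 1) * (p (c j) - p (c i))"
      using that(3) N(1) K(1) by (intro mult_left_mono) auto
    then show ?thesis using v[OF that(1)] v[OF that(2)] K(1)
      by (simp add: z_def right_diff_distrib)
  qed
  have z_same: "z p i - z p j = v i - v j" if "c i = c j" for p i j
    using that by (simp add: z_def)
  have blow_up: "holds r y = holds r (z y)"
    if yv: "\<And>i. i \<in> ?A \<Longrightarrow> y i - y (c i) = v i"
      and yc: "\<And>i j. i \<in> ?A \<Longrightarrow> j \<in> ?A \<Longrightarrow> c i \<noteq> c j \<Longrightarrow> 2 * K < \<bar>y i - y j\<bar>" for y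
  proof (rule invariantD[OF invariant_lt_of_cyc[OF N(2)]])
    show "lt_eq N ?A y (z y)" unfolding lt_eq_def
    proof (intro ballI)
      fix i j assume ij: "i \<in> ?A" "j \<in> ?A"
      show "trunc_eq N (y i - y j) (z y i - z y j)"
      proof (cases "c i = c j")
        case True
        then have "y i - y j = v i - v j" using yv[OF ij(1)] yv[OF ij(2)] by simp
        with z_same[OF True] show ?thesis by (simp add: trunc_eq_def)
      next
        case False
        note b = yc[OF ij False] yv[OF ij(1)] yv[OF ij(2)] v[OF ij(1)] v[OF ij(2)] K(1) N(1)
        show ?thesis
        proof (cases "y i < y j")
          case True
          then have "y (c i) < y (c j)" using b by linarith
          from z[OF ij this] True b show ?thesis by (simp add: trunc_eq_def)
        next
          case False
          then have "y (c j) < y (c i)" using b by linarith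
          from z[OF ij(2,1) this] False b show ?thesis by (simp add: trunc_eq_def)
        qed
      qed
    qed
  qed
  let ?C = "c ` ?A"
  have inj: "inj_on y ?C" if "\<And>i j. i \<in> ?A \<Longrightarrow> j \<in> ?A \<Longrightarrow> c i \<noteq> c j \<Longrightarrow> 2 * K < \<bar>y i - y j :: int\<bar>" for y
  proof (rule inj_onI)
    fix a b assume "a \<in> ?C" "b \<in> ?C" "y a = y b"
    then show "a = b" using that[of a b] c(1) cc N(1) K(1) by force
  qed
  have nz: "holds r (z x) \<noteq> holds r (z x')"
    using ne blow_up[of x] blow_up[of x'] v_def v' c(3) c' by simp
  have "\<exists>p a b. inj_on p ?C \<and> a \<in> ?C \<and> b \<in> ?C \<and> p a < p b \<and>
    (\<forall>d\<in>?C. \<not> (p a < p d \<and> p d < p b)) \<and> holds r (z (p(a := p b, b := p a))) \<noteq> holds r (z p)"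
  proof (rule ccontr)
    assume no: "\<not> ?thesis"
    have "holds r (z x) = holds r (z x')"
    proof (rule adjacent_transpositions_connect[where g = "\<lambda>p. holds r (z p)" and C = ?C])
      show "inj_on x ?C" by (rule inj[OF c(3)])
      show "inj_on x' ?C" by (rule inj[OF c'])
      fix p :: "nat \<Rightarrow> int"
      assume ord: "\<And>a b. a \<in> ?C \<Longrightarrow> b \<in> ?C \<Longrightarrow> p a < p b \<longleftrightarrow> x' a < x' b"
      assume p: "inj_on p ?C"
      have "lt_eq N ?A (z p) (z x')"
      \<comment> \<open>The rank of a cluster turns the integer positions into the natural block
        numbers of \<open>lt_eq_blocks\<close>.\<close>
      proof (rule lt_eq_blocks[OF N(1), where \<kappa> = "\<lambda>i. card {d \<in> ?C. p d < p (c i)}"])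
        fix i j assume ij: "i \<in> ?A" "j \<in> ?A"
        have mono: "card {d \<in> ?C. p d < p (c i)} < card {d \<in> ?C. p d < p (c j)}"
          if "p (c i) < p (c j)" "i \<in> ?A" for i j
          by (rule psubset_card_mono) (use that in auto)
        show "z p i - z p j = z x' i - z x' j"
          if "card {d \<in> ?C. p d < p (c i)} = card {d \<in> ?C. p d < p (c j)}"
        proof -
          have "p (c i) = p (c j)" using that mono[of i j] mono[of j i] ij by linarith
          then have "c i = c j" using p ij by (auto dest: inj_onD)
          then show ?thesis by (simp only: z_same)
        qed
        show "z p i + N < z p j \<and> z x' i + N < z x' j"
          if "card {d \<in> ?C. p d < p (c i)} < card {d \<in> ?C. p d < p (c j)}"
        proof -
          have "\<not> p (c j) < p (c i)" using that mono[of j i] ij by linarith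
          moreover have "p (c i) \<noteq> p (c j)" using that by auto
          ultimately have "p (c i) < p (c j)" by linarith
          with ord[of "c i" "c j"] z ij show ?thesis by blast
        qed
      qed
      then show "holds r (z p) = holds r (z x')"
        by (rule invariantD[OF invariant_lt_of_cyc[OF N(2)]])
    qed (use no in \<open>blast | simp\<close>)+
    with nz show False by contradiction
  qed
  then obtain p a b where p: "inj_on p ?C" and ab: "a \<in> ?C" "b \<in> ?C" "p a < p b"
    and adj: "\<And>d. d \<in> ?C \<Longrightarrow> \<not> (p a < p d \<and> p d < p b)"
    and swap: "holds r (z (p(a := p b, b := p a))) \<noteq> holds r (z p)" by blast
  define q where "q = p(a := p b, b := p a)"
  \<comment> \<open>The exchanged clusters are blocks \<open>1\<close> and \<open>2\<close>; all
    clusters below them form block \<open>0\<close>, all above them block \<open>3\<close>.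
    Adjacency of \<open>a\<close> and \<open>b\<close> guarantees that nothing lies between.\<close>
  define \<kappa> :: "nat \<Rightarrow> nat" where
    "\<kappa> i = (if c i = a then 1 else if c i = b then 2 else if p (c i) < p a then 0 else 3)" for i
  have above: "p b < p (c i)" if "i \<in> ?A" "c i \<noteq> a" "c i \<noteq> b" "\<not> p (c i) < p a" for i
  proof -
    have "p (c i) \<noteq> p a" "p (c i) \<noteq> p b" using that p ab by (auto dest: inj_onD)
    with adj[of "c i"] that show ?thesis by force
  qed
  have "a \<noteq> b" using ab by auto
  have kinds: "\<kappa> i = 1 \<and> p (c i) = p a \<and> q (c i) = p b \<or>
      \<kappa> i = 2 \<and> p (c i) = p b \<and> q (c i) = p a \<or>
      \<kappa> i = 0 \<and> p (c i) < p a \<and> q (c i) = p (c i) \<or>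
      \<kappa> i = 3 \<and> p b < p (c i) \<and> q (c i) = p (c i)" if "i \<in> ?A" for i
    using above[OF that] \<open>a \<noteq> b\<close> by (simp add: \<kappa>_def q_def)
  show ?thesis
  proof (rule C_mem_of_block_swap[OF V N, where \<kappa> = \<kappa> and z = "z p" and z' = "z q"])
    show "\<kappa> i \<le> 3" for i by (simp add: \<kappa>_def)
    show "holds r (z p) \<noteq> holds r (z q)" using swap by (simp add: q_def)
    fix i j assume "i < fst r" "j < fst r"
    then have ij: "i \<in> ?A" "j \<in> ?A" by auto
    show "z p i + N < z p j" if "\<kappa> i < \<kappa> j"
    proof (rule z[OF ij])
      show "p (c i) < p (c j)"
        using kinds[OF ij(1)] kinds[OF ij(2)] that ab(3) by (elim disjE) simp_all
    qed
    show "z q i + N < z q j"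
      if "(if \<kappa> i = 1 then 2 else if \<kappa> i = 2 then 1 else \<kappa> i) < (if \<kappa> j = 1 then 2 else if \<kappa> j = 2 then 1 else \<kappa> j)"
    proof (rule z[OF ij])
      show "q (c i) < q (c j)"
        using kinds[OF ij(1)] kinds[OF ij(2)] that ab(3) by (elim disjE) simp_all
    qed
    show "z p i - z p j = z q i - z q j" if eq: "\<kappa> i = \<kappa> j"
    proof -
      consider "c i = c j" | "c i \<noteq> a" "c i \<noteq> b" "c j \<noteq> a" "c j \<noteq> b"
        using eq unfolding \<kappa>_def
        by (cases "c i = a"; cases "c i = b"; cases "c j = a"; cases "c j = b") (simp_all split: if_splits)
      then show ?thesis
      proof cases
        case 1
        then show ?thesis by (simp only: z_same)
      next
        case 2
        then show ?thesis by (simp add: z_def q_def)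
      qed
    qed
  qed
qed

section \<open>The six spaces\<close>

lemma B_rel_iff: "[a, b, c] \<in> snd B_rel \<longleftrightarrow> betw a b c"
  by (simp add: B_rel_def)

lemma S_rel_iff: "[a, b, c, d] \<in> snd S_rel \<longleftrightarrow>
    (betw a b c \<or> betw a d c) \<and> (betw b a d \<or> betw b c d)"
  by (simp add: S_rel_def)

lemma mem_spanI: "wf_rel r \<Longrightarrow> fdef {R} (fst r) (holds r) \<Longrightarrow> r \<in> span R"
  by (simp add: span_def definable_iff)

lemma S_mem_span_B: "S_rel \<in> span B_rel"
proof (rule mem_spanI[OF wf_rels(6)])
  have atom: "fdef {B_rel} 4 (\<lambda>e. map e [i, j, k] \<in> snd B_rel)" if "i < 4" "j < 4" "k < 4" for i j k
    by (rule fdef_atom) (use that in \<open>auto simp: fst_rels\<close>)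
  show "fdef {B_rel} (fst S_rel) (holds S_rel)"
    unfolding fst_rels
    by (rule fdef_cong[OF _ fdef_conj[OF
          fdef_disj[OF atom[of 0 1 2] atom[of 0 3 2]] fdef_disj[OF atom[of 1 0 3] atom[of 1 2 3]]]])
       (simp_all add: holds_rels B_rel_iff)
qed

text \<open>On a circle, \<open>{a, c}\<close> separates \<open>{b, d}\<close> if \<open>b\<close>
  lies on one arc between \<open>a\<close> and \<open>c\<close> and \<open>d\<close> on the
  other.\<close>

lemma separation_iff_cyc:
  "(betw a b c \<or> betw a d c) \<and> (betw b a d \<or> betw b c d) \<longleftrightarrow>
    cyc a b c \<and> cyc c d a \<or> cyc c b a \<and> cyc a d c"
  unfolding betw_def cyc_def
  by (smt (verit))

lemma S_mem_span_C: "S_rel \<in> span C_rel"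
proof (rule mem_spanI[OF wf_rels(6)])
  have atom: "fdef {C_rel} 4 (\<lambda>e. map e [i, j, k] \<in> snd C_rel)" if "i < 4" "j < 4" "k < 4" for i j k
    by (rule fdef_atom) (use that in \<open>auto simp: fst_rels\<close>)
  show "fdef {C_rel} (fst S_rel) (holds S_rel)"
    unfolding fst_rels
    by (rule fdef_cong[OF _ fdef_disj[OF
          fdef_conj[OF atom[of 0 1 2] atom[of 2 3 0]] fdef_conj[OF atom[of 2 1 0] atom[of 0 3 2]]]])
       (simp_all add: holds_rels C_rel_iff separation_iff_cyc)
qed

lemma B_mem_span_lt: "B_rel \<in> span lt_rel"
proof (rule mem_spanI[OF wf_rels(4)])
  have atom: "fdef {lt_rel} 3 (\<lambda>e. map e [i, j] \<in> snd lt_rel)" if "i < 3" "j < 3" for i j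
    by (rule fdef_atom) (use that in \<open>auto simp: fst_rels\<close>)
  show "fdef {lt_rel} (fst B_rel) (holds B_rel)"
    unfolding fst_rels
    by (rule fdef_cong[OF _ fdef_disj[OF
          fdef_conj[OF atom[of 0 1] atom[of 1 2]] fdef_conj[OF atom[of 1 0] atom[of 2 1]]]])
       (simp_all add: holds_rels snd_rels betw_def)
qed

lemma C_mem_span_lt: "C_rel \<in> span lt_rel"
proof (rule mem_spanI[OF wf_rels(5)])
  have atom: "fdef {lt_rel} 3 (\<lambda>e. map e [i, j] \<in> snd lt_rel)" if "i < 3" "j < 3" for i j
    by (rule fdef_atom) (use that in \<open>auto simp: fst_rels\<close>)
  show "fdef {lt_rel} (fst C_rel) (holds C_rel)"
    unfolding fst_rels
    by (rule fdef_cong[OF _ fdef_disj[OF fdef_conj[OF atom[of 0 1] atom[of 1 2]]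
          fdef_disj[OF fdef_conj[OF atom[of 1 2] atom[of 2 0]] fdef_conj[OF atom[of 2 0] atom[of 0 1]]]]])
       (simp_all add: holds_rels snd_rels cyc_def)
qed

lemma A11_mem_span_succ: "A11_rel \<in> span succ_rel"
proof (rule mem_spanI[OF wf_rels(3)])
  have atom: "fdef {succ_rel} 4 (\<lambda>e. map e [i, j] \<in> snd succ_rel)" if "i < 4" "j < 4" for i j
    by (rule fdef_atom) (use that in \<open>auto simp: fst_rels\<close>)
  show "fdef {succ_rel} (fst A11_rel) (holds A11_rel)"
    unfolding fst_rels
    by (rule fdef_cong[OF _ fdef_disj[OF
          fdef_conj[OF atom[of 0 1] atom[of 2 3]] fdef_conj[OF atom[of 1 0] atom[of 3 2]]]])
       (auto simp: holds_rels snd_rels)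
qed

text \<open>Distinct points are adjacent exactly if one of the two arcs between them is
  empty.\<close>

lemma adjacent_iff_not_separated:
  "x \<noteq> y \<and> \<not> (\<exists>a b. [x, a, y, b] \<in> snd S_rel) \<longleftrightarrow> \<bar>x - y\<bar> = 1"
proof
  assume h: "x \<noteq> y \<and> \<not> (\<exists>a b. [x, a, y, b] \<in> snd S_rel)"
  \<comment> \<open>The first tuple refutes a gap when \<open>x < y\<close>, the second when
    \<open>x > y\<close>.\<close>
  then have "[x, x + 1, y, y + 1] \<notin> snd S_rel" "[x, x - 1, y, y - 1] \<notin> snd S_rel" "x \<noteq> y" by auto
  then show "\<bar>x - y\<bar> = 1" unfolding S_rel_iff betw_def by auto
next
  assume "\<bar>x - y\<bar> = 1"
  then have "x = y + 1 \<or> y = x + 1" by linarith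
  then show "x \<noteq> y \<and> \<not> (\<exists>a b. [x, a, y, b] \<in> snd S_rel)"
    unfolding S_rel_iff betw_def by auto
qed

text \<open>Two disjoint edges \<open>(x, y)\<close> and \<open>(z, t)\<close> point in the same direction iff \<open>{x, z}\<close>
  separates \<open>{y, t}\<close>.\<close>
lemma codirection_iff:
  "x - y = z - t \<and> \<bar>x - y\<bar> = 1 \<longleftrightarrow> \<bar>x - y\<bar> = 1 \<and> \<bar>z - t\<bar> = 1 \<and>
    (x = z \<and> y = t \<or> y = z \<and> x \<noteq> t \<or> x = t \<and> y \<noteq> z \<or> [x, y, z, t] \<in> snd S_rel)"
proof (cases "\<bar>x - y\<bar> = 1 \<and> \<bar>z - t\<bar> = 1")
  case True
  then consider "y = x + 1" "t = z + 1" | "y = x + 1" "t = z - 1" | "y = x - 1" "t = z + 1" | "y = x - 1" "t = z - 1"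
    by linarith
  then show ?thesis unfolding S_rel_iff betw_def by cases auto
qed auto

lemma A11_mem_span_S: "A11_rel \<in> span S_rel"
proof (rule mem_spanI[OF wf_rels(3)])
  let ?adj = "\<lambda>i j. Conj (Neg (Eq i j)) (Neg (Ex 4 (Ex 5 (Atom S_rel [i, 4, j, 5]))))"
  have "over {S_rel} (?adj i j)" "fv (?adj i j) \<subseteq> {..<4}"
    "sat e (?adj i j) \<longleftrightarrow> \<bar>e i - e j\<bar> = 1" if "i < 4" "j < 4" for i j e
    using that adjacent_iff_not_separated[of "e i" "e j"] by (auto simp: fst_rels)
  then have adj: "fdef {S_rel} 4 (\<lambda>e. \<bar>e i - e j\<bar> = 1)" if "i < 4" "j < 4" for i j
    using that unfolding fdef_def by (intro exI[of _ "?adj i j"]) blast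
  have S: "fdef {S_rel} 4 (\<lambda>e. map e [0, 1, 2, 3] \<in> snd S_rel)"
    by (rule fdef_atom) (auto simp: fst_rels)
  have eq: "fdef {S_rel} 4 (\<lambda>e. e i = e j)" if "i < 4" "j < 4" for i j
    using that by (rule fdef_eq)
  have *: "fdef {S_rel} 4 (\<lambda>e. \<bar>e 0 - e 1\<bar> = 1 \<and> \<bar>e 2 - e 3\<bar> = 1 \<and>
    (e 0 = e 2 \<and> e 1 = e 3 \<or> e 1 = e 2 \<and> e 0 \<noteq> e 3 \<or> e 0 = e 3 \<and> e 1 \<noteq> e 2 \<or>
     map e [0, 1, 2, 3] \<in> snd S_rel))"
    by (intro fdef_conj fdef_disj fdef_not adj eq S) simp_all
  show "fdef {S_rel} (fst A11_rel) (holds A11_rel)"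
    unfolding fst_rels
    by (rule fdef_cong[OF _ *]) (simp add: holds_rels codirection_iff)
qed

lemma span_mono: "R \<in> span R' \<Longrightarrow> span R \<subseteq> span R'"
  by (rule span_least[OF dspace_span])

lemma span_inclusions:
  "span A11_rel \<subseteq> span succ_rel" "span A11_rel \<subseteq> span S_rel" "span S_rel \<subseteq> span B_rel"
  "span S_rel \<subseteq> span C_rel" "span succ_rel \<subseteq> span C_rel" "span B_rel \<subseteq> span lt_rel"
  "span C_rel \<subseteq> span lt_rel"
  by (intro span_mono A11_mem_span_succ A11_mem_span_S S_mem_span_B S_mem_span_C C_defines_succ
      B_mem_span_lt C_mem_span_lt)+

lemma refl_inv_betw_rels: "refl_inv A11_rel" "refl_inv S_rel" "refl_inv B_rel"
  unfolding refl_inv_def holds_rels betw_def by auto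

lemma not_refl_inv_succ: "\<not> refl_inv succ_rel"
  unfolding refl_inv_def holds_rels by (auto intro!: exI[of _ "int"])

lemma refl_inv_span: "refl_inv R \<Longrightarrow> r \<in> span R \<Longrightarrow> refl_inv r"
  unfolding span_eq_gen by (rule refl_inv_gen) auto

lemma succ_notin_span_B: "succ_rel \<notin> span B_rel"
  using refl_inv_span[OF refl_inv_betw_rels(3)] not_refl_inv_succ by blast

text \<open>Among four points with all distances above \<open>N\<close>, any permutation is
  invisible to \<open>succ_eq\<close>; exchanging the two middle points destroys separation.\<close>

lemma S_not_succ_invariant:
  assumes "0 \<le> N" shows "\<not> invariant succ_eq N S_rel"
proof
  assume inv: "invariant succ_eq N S_rel"
  define M where "M = N + 1"
  define e where "e = (\<lambda>i :: nat. if i = 0 then 0 else if i = 1 then M else if i = 2 then 2 * M else 3 * M)"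
  define e' where "e' = (\<lambda>i :: nat. if i = 0 then 0 else if i = 1 then 2 * M else if i = 2 then M else 3 * M)"
  have "succ_eq N {..<4} e e'"
  proof (rule succ_eqI)
    fix i j :: nat
    assume "i \<in> {..<4}" "j \<in> {..<4}" and near: "\<bar>e i - e j\<bar> \<le> N \<or> \<bar>e' i - e' j\<bar> \<le> N"
    then have "i = 0 \<or> i = 1 \<or> i = 2 \<or> i = 3" "j = 0 \<or> j = 1 \<or> j = 2 \<or> j = 3" by auto
    then have "i = j" using near assms by (elim disjE) (simp_all add: e_def e'_def M_def)
    then show "e i - e j = e' i - e' j" by simp
  qed
  then have "holds S_rel e = holds S_rel e'" using invariantD[OF inv] by (simp add: fst_rels)
  then show False using assms by (simp add: holds_rels e_def e'_def betw_def M_def)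
qed

lemma S_notin_span_succ: "S_rel \<notin> span succ_rel"
  using succ.span_invariant S_not_succ_invariant by blast

text \<open>Rotating the lowest of three far apart points to the top changes which of them is in the
  middle.\<close>

lemma B_not_cyc_invariant:
  assumes "0 \<le> N" shows "\<not> invariant cyc_eq N B_rel"
proof
  assume inv: "invariant cyc_eq N B_rel"
  define M where "M = N + 1"
  define e where "e = (\<lambda>i :: nat. if i = 0 then 0 else if i = 1 then M else 2 * M)"
  define e' where "e' = (\<lambda>i :: nat. if i = 0 then 3 * M else if i = 1 then M else 2 * M)"
  have "{..<3} - {0} = {1, 2 :: nat}" by auto
  then have "rot_eq {0} N {..<3} e e'"
    unfolding rot_eq_def using assms
    by (auto simp: e_def e'_def lt_eq_def trunc_eq_def M_def)
  then have "cyc_eq N {..<3} e e'" by (auto simp: cyc_eq_def)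
  then have "holds B_rel e = holds B_rel e'" using invariantD[OF inv] by (simp add: fst_rels)
  then show False using assms by (simp add: holds_rels e_def e'_def betw_def M_def)
qed

lemma B_notin_span_C: "B_rel \<notin> span C_rel"
  using cyc.span_invariant B_not_cyc_invariant by blast

section \<open>Spaces containing the successor relation\<close>

lemma dspace_with_succ:
  assumes V: "dspace V" "succ_rel \<in> V" "V \<subseteq> span lt_rel"
  shows "V = span succ_rel \<or> V = span C_rel \<or> V = span lt_rel"
proof (cases "lt_rel \<in> V")
  case True
  then show ?thesis using span_least[OF V(1)] V(3) by blast
next
  case False
  have inv: "\<exists>N\<ge>0. invariant cyc_eq N r" if r: "r \<in> V" for r
  proof -
    obtain N where "0 \<le> N" "invariant lt_eq N r" using lt.span_invariant r V(3) by blast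
    then show ?thesis using lt_mem_of_not_cyc_invariant[OF V(1,2) r] False by blast
  qed
  have C: "V \<subseteq> span C_rel"
    using inv mem_span_C wf_in_dspace[OF V(1)] by blast
  show ?thesis
  proof (cases "C_rel \<in> V")
    case True
    then show ?thesis using span_least[OF V(1)] C by blast
  next
    case False
    have "r \<in> span succ_rel" if r: "r \<in> V" for r
    proof -
      obtain N where "0 \<le> N" "invariant cyc_eq N r" using inv[OF r] by blast
      then obtain M where "invariant succ_eq M r"
        using C_mem_of_not_succ_invariant[OF V(1,2) r] False by blast
      then show ?thesis using mem_span_succ wf_in_dspace[OF V(1) r] by blast
    qed
    then show ?thesis using span_least[OF V(1,2)] by blast
  qed
qed

section \<open>Spaces not containing the successor relation\<close>

text \<open>Relative to an edge \<open>(p, q)\<close> with \<open>q = p + 1\<close>, codirection defines the successor.\<close>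
lemma orient_formula:
  assumes "A11_rel \<in> V"
  shows "over (insert succ_rel V) \<phi> \<Longrightarrow> \<exists>k. \<forall>p\<ge>k. \<forall>q\<ge>k. \<exists>\<psi>. over V \<psi> \<and> fv \<psi> \<subseteq> fv \<phi> \<union> {p, q} \<and>
    (\<forall>e. e q = e p + 1 \<longrightarrow> sat e \<psi> = sat e \<phi>)"
proof (induction \<phi>)
  case (Eq i j)
  show ?case by (intro exI[of _ 0] allI impI, rule_tac x = "Eq i j" in exI) auto
next
  case (Atom Q vs)
  show ?case
  proof (cases "Q \<in> V")
    case True
    with Atom show ?thesis
      by (intro exI[of _ 0] allI impI, rule_tac x = "Atom Q vs" in exI) auto
  next
    case False
    with Atom have Q: "Q = succ_rel" by auto
    with Atom obtain i j where vs: "vs = [i, j]"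
      by (auto simp: fst_rels length_Suc_conv numeral_2_eq_2)
    show ?thesis
      \<comment> \<open>Since \<open>e q - e p = 1\<close>, codirection of \<open>(q, p)\<close> and
        \<open>(j, i)\<close> says \<open>e j = e i + 1\<close>.\<close>
      by (intro exI[of _ 0] allI impI, rule_tac x = "Atom A11_rel [q, p, j, i]" in exI)
         (use assms in \<open>auto simp: Q vs fst_rels snd_rels\<close>)
  qed
next
  case (Neg \<phi>)
  then have "over (insert succ_rel V) \<phi>" by simp
  from Neg.IH[OF this] obtain k where k: "\<forall>p\<ge>k. \<forall>q\<ge>k. \<exists>\<psi>. over V \<psi> \<and> fv \<psi> \<subseteq> fv \<phi> \<union> {p, q} \<and>
    (\<forall>e. e q = e p + 1 \<longrightarrow> sat e \<psi> = sat e \<phi>)" by blast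
  show ?case
  proof (intro exI[of _ k] allI impI)
    fix p q assume "k \<le> p" "k \<le> q"
    with k obtain \<psi> where "over V \<psi>" "fv \<psi> \<subseteq> fv \<phi> \<union> {p, q}"
      "\<forall>e. e q = e p + 1 \<longrightarrow> sat e \<psi> = sat e \<phi>" by blast
    then show "\<exists>\<psi>. over V \<psi> \<and> fv \<psi> \<subseteq> fv (Neg \<phi>) \<union> {p, q} \<and>
        (\<forall>e. e q = e p + 1 \<longrightarrow> sat e \<psi> = sat e (Neg \<phi>))"
      by (intro exI[of _ "Neg \<psi>"]) auto
  qed
next
  case (Conj \<phi>1 \<phi>2)
  then have "over (insert succ_rel V) \<phi>1" "over (insert succ_rel V) \<phi>2" by simp_all
  from Conj.IH(1)[OF this(1)] Conj.IH(2)[OF this(2)] obtain k1 k2 where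
    k1: "\<forall>p\<ge>k1. \<forall>q\<ge>k1. \<exists>\<psi>. over V \<psi> \<and> fv \<psi> \<subseteq> fv \<phi>1 \<union> {p, q} \<and>
      (\<forall>e. e q = e p + 1 \<longrightarrow> sat e \<psi> = sat e \<phi>1)" and
    k2: "\<forall>p\<ge>k2. \<forall>q\<ge>k2. \<exists>\<psi>. over V \<psi> \<and> fv \<psi> \<subseteq> fv \<phi>2 \<union> {p, q} \<and>
      (\<forall>e. e q = e p + 1 \<longrightarrow> sat e \<psi> = sat e \<phi>2)" by (elim exE)
  show ?case
  proof (intro exI[of _ "max k1 k2"] allI impI)
    fix p q assume "max k1 k2 \<le> p" "max k1 k2 \<le> q"
    then have "k1 \<le> p" "k1 \<le> q" "k2 \<le> p" "k2 \<le> q" by auto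
    obtain \<psi>1 where
      "over V \<psi>1" "fv \<psi>1 \<subseteq> fv \<phi>1 \<union> {p, q}" "\<forall>e. e q = e p + 1 \<longrightarrow> sat e \<psi>1 = sat e \<phi>1"
      using k1[rule_format, OF \<open>k1 \<le> p\<close> \<open>k1 \<le> q\<close>] by blast
    moreover obtain \<psi>2 where
      "over V \<psi>2" "fv \<psi>2 \<subseteq> fv \<phi>2 \<union> {p, q}" "\<forall>e. e q = e p + 1 \<longrightarrow> sat e \<psi>2 = sat e \<phi>2"
      using k2[rule_format, OF \<open>k2 \<le> p\<close> \<open>k2 \<le> q\<close>] by blast
    ultimately show "\<exists>\<psi>. over V \<psi> \<and> fv \<psi> \<subseteq> fv (Conj \<phi>1 \<phi>2) \<union> {p, q} \<and>
        (\<forall>e. e q = e p + 1 \<longrightarrow> sat e \<psi> = sat e (Conj \<phi>1 \<phi>2))"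
      by (intro exI[of _ "Conj \<psi>1 \<psi>2"]) auto
  qed
next
  case (Ex x \<phi>)
  then have "over (insert succ_rel V) \<phi>" by simp
  from Ex.IH[OF this] obtain k where k: "\<forall>p\<ge>k. \<forall>q\<ge>k. \<exists>\<psi>. over V \<psi> \<and> fv \<psi> \<subseteq> fv \<phi> \<union> {p, q} \<and>
    (\<forall>e. e q = e p + 1 \<longrightarrow> sat e \<psi> = sat e \<phi>)" by blast
  show ?case
  \<comment> \<open>The variables \<open>p\<close> and \<open>q\<close> stay above every quantified
    variable, so no quantifier captures the orienting edge.\<close>
  proof (intro exI[of _ "max k (Suc x)"] allI impI)
    fix p q assume pq: "max k (Suc x) \<le> p" "max k (Suc x) \<le> q"
    then have "k \<le> p" "k \<le> q" by auto
    with k obtain \<psi> where \<psi>: "over V \<psi>" "fv \<psi> \<subseteq> fv \<phi> \<union> {p, q}"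
      "\<And>e. e q = e p + 1 \<Longrightarrow> sat e \<psi> = sat e \<phi>" by blast
    have "sat (e(x := a)) \<psi> = sat (e(x := a)) \<phi>" if "e q = e p + 1" for e a
      using that pq by (intro \<psi>(3)) auto
    with \<psi>(1,2) show "\<exists>\<psi>. over V \<psi> \<and> fv \<psi> \<subseteq> fv (Ex x \<phi>) \<union> {p, q} \<and>
        (\<forall>e. e q = e p + 1 \<longrightarrow> sat e \<psi> = sat e (Ex x \<phi>))"
      by (intro exI[of _ "Ex x \<psi>"]) auto
  qed
qed

lemma holds_cong: "(\<And>i. i < fst r \<Longrightarrow> e i = e' i) \<Longrightarrow> holds r e = holds r e'"
proof -
  assume "\<And>i. i < fst r \<Longrightarrow> e i = e' i"
  then have m: "map e [0..<fst r] = map e' [0..<fst r]" by simp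
  show ?thesis by (simp only: holds_def m)
qed

text \<open>The orienting edge is quantified away. On an edge pointing up the oriented formula
  expresses \<open>r\<close>; on one pointing down it expresses \<open>r\<close> at the mirror
  image, which is the same for reflection invariant \<open>r\<close>.\<close>

lemma refl_inv_part_subset:
  assumes V: "dspace V" "A11_rel \<in> V" "\<And>r. r \<in> V \<Longrightarrow> refl_inv r"
    and r: "r \<in> gen (insert succ_rel V)" "refl_inv r"
  shows "r \<in> V"
proof -
  obtain \<phi> where \<phi>: "over (insert succ_rel V) \<phi>" "fv \<phi> \<subseteq> {..<fst r}" "\<And>e. sat e \<phi> = holds r e"
    and wf: "wf_rel r"
    using r(1) by (auto simp: gen_def definable_iff fdef_def)
  obtain k where k: "\<forall>p\<ge>k. \<forall>q\<ge>k. \<exists>\<psi>. over V \<psi> \<and> fv \<psi> \<subseteq> fv \<phi> \<union> {p, q} \<and>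
    (\<forall>e. e q = e p + 1 \<longrightarrow> sat e \<psi> = sat e \<phi>)" using orient_formula[OF V(2) \<phi>(1)] by blast
  define p q where "p = max k (fst r)" and "q = Suc p"
  have "k \<le> p" "k \<le> q" by (auto simp: p_def q_def)
  with k obtain \<psi> where \<psi>: "over V \<psi>" "fv \<psi> \<subseteq> fv \<phi> \<union> {p, q}"
    "\<And>e. e q = e p + 1 \<Longrightarrow> sat e \<psi> = sat e \<phi>" by blast
  have pq: "fst r \<le> p" "fst r \<le> q" "p \<noteq> q" by (auto simp: p_def q_def)
  let ?\<chi> = "Ex p (Ex q (Conj (Atom A11_rel [p, q, p, q]) \<psi>))"
  have inner: "sat (e(p := a, q := b)) \<psi> = holds r e" if ab: "\<bar>a - b\<bar> = 1" for e a b
  proof -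
    let ?e = "e(p := a, q := b)"
    have e: "holds r ?e = holds r e" by (rule holds_cong) (use pq in auto)
    consider "b = a + 1" | "b = a - 1" using ab by linarith
    then show ?thesis
    proof cases
      case 1
      then have "sat ?e \<psi> = sat ?e \<phi>" using pq(3) by (intro \<psi>(3)) simp
      then show ?thesis using \<phi>(3) e by simp
    next
      case 2
      \<comment> \<open>\<open>\<psi>\<close> uses only relations of \<open>V\<close> and so does
        not notice the reflection, which turns the edge upwards.\<close>
      have "sat ?e \<psi> = sat (\<lambda>i. - ?e i) \<psi>" using sat_refl[OF V(3) \<psi>(1)] by blast
      also have "\<dots> = sat (\<lambda>i. - ?e i) \<phi>" using pq(3) 2 by (intro \<psi>(3)) simp
      also have "\<dots> = holds r ?e"
        using \<phi>(3) r(2)[unfolded refl_inv_def, rule_format, of ?e] by blast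
      finally show ?thesis using e by simp
    qed
  qed
  have "sat e ?\<chi> = holds r e" for e
  proof -
    have "sat e ?\<chi> \<longleftrightarrow> (\<exists>a b. \<bar>a - b\<bar> = 1 \<and> sat (e(p := a, q := b)) \<psi>)"
      using pq(3) by (simp add: snd_rels)
    also have "\<dots> \<longleftrightarrow> (\<exists>a b :: int. \<bar>a - b\<bar> = 1 \<and> holds r e)"
      using inner by blast
    also have "\<dots> \<longleftrightarrow> holds r e"
    proof -
      have "\<exists>a b :: int. \<bar>a - b\<bar> = 1" by (rule exI[of _ 0], rule exI[of _ 1]) simp
      then show ?thesis by blast
    qed
    finally show ?thesis .
  qed
  moreover have "over V ?\<chi>" using \<psi>(1) V(2) by (simp add: fst_rels)
  moreover have "fv ?\<chi> \<subseteq> {..<fst r}" using \<psi>(2) \<phi>(2) by auto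
  ultimately have "fdef V (fst r) (holds r)" unfolding fdef_def by blast
  then show ?thesis using fdef_in_dspace[OF V(1) wf] by blast
qed

text \<open>Thus a reflection invariant space containing codirection is determined by what it
  generates together with \<open>+1\<close>.\<close>

lemma eq_refl_inv_part:
  assumes V: "dspace V" "A11_rel \<in> V" "\<And>r. r \<in> V \<Longrightarrow> refl_inv r"
  shows "V = {r \<in> gen (insert succ_rel V). refl_inv r}"
proof (intro equalityI subsetI)
  fix r assume r: "r \<in> V"
  then have "definable (insert succ_rel V) r" using wf_in_dspace[OF V(1)] by (intro definable_self) auto
  with V(3)[OF r] show "r \<in> {r \<in> gen (insert succ_rel V). refl_inv r}" by (simp add: gen_def)
next
  fix r assume "r \<in> {r \<in> gen (insert succ_rel V). refl_inv r}"
  then show "r \<in> V" using refl_inv_part_subset[OF V] by blast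
qed

lemma gen_insert_succ:
  assumes "V \<subseteq> span lt_rel" "dspace V"
  shows "gen (insert succ_rel V) = span succ_rel \<or> gen (insert succ_rel V) = span C_rel \<or>
      gen (insert succ_rel V) = span lt_rel"
    and "V \<subseteq> gen (insert succ_rel V)" "span succ_rel \<subseteq> gen (insert succ_rel V)"
proof -
  have self: "r \<in> gen (insert succ_rel V)" if "r \<in> insert succ_rel V" for r
  proof -
    have "wf_rel r" using that wf_in_dspace[OF assms(2)] wf_rels(2) by blast
    from definable_self[OF this that] show ?thesis by (simp add: gen_def)
  qed
  then show "V \<subseteq> gen (insert succ_rel V)" by blast
  show "span succ_rel \<subseteq> gen (insert succ_rel V)"
    using self by (intro span_least dspace_gen) auto
  have "succ_rel \<in> span lt_rel" using C_defines_succ span_inclusions(7) by blast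
  then have "gen (insert succ_rel V) \<subseteq> span lt_rel"
    using assms(1) by (intro gen_least dspace_span) auto
  then show "gen (insert succ_rel V) = span succ_rel \<or> gen (insert succ_rel V) = span C_rel \<or>
      gen (insert succ_rel V) = span lt_rel"
    using self by (intro dspace_with_succ dspace_gen) auto
qed

text \<open>Each space is identified by elimination among the three spaces containing
  \<open>+1\<close>, in place of explicit formulas for \<open>C\<close> from \<open>S\<close> and
  \<open>+1\<close>, or for \<open><\<close> from \<open>B\<close> and \<open>+1\<close>.\<close>

lemma gen_insert_succ_span:
  "gen (insert succ_rel (span A11_rel)) = span succ_rel"
  "gen (insert succ_rel (span S_rel)) = span C_rel"
  "gen (insert succ_rel (span B_rel)) = span lt_rel"
proof -
  note incl = span_inclusions
  have mem: "succ_rel \<in> span succ_rel" "S_rel \<in> span S_rel" "B_rel \<in> span B_rel"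
    by (simp_all add: in_span wf_rels)
  have A: "span A11_rel \<subseteq> span lt_rel" and S: "span S_rel \<subseteq> span lt_rel" using incl by blast+
  have "gen (insert succ_rel (span A11_rel)) \<subseteq> span succ_rel"
    using incl(1) mem(1) by (intro gen_least dspace_span) auto
  then show "gen (insert succ_rel (span A11_rel)) = span succ_rel"
    using gen_insert_succ(3)[OF A dspace_span] by blast
  have "gen (insert succ_rel (span S_rel)) \<subseteq> span C_rel"
    using incl(4) C_defines_succ by (intro gen_least dspace_span) auto
  moreover have "gen (insert succ_rel (span S_rel)) \<noteq> span succ_rel"
    using gen_insert_succ(2)[OF S dspace_span] mem(2) S_notin_span_succ by blast
  ultimately show "gen (insert succ_rel (span S_rel)) = span C_rel"
    using gen_insert_succ(1)[OF S dspace_span] incl(7) by blast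
  have "B_rel \<in> gen (insert succ_rel (span B_rel))" "S_rel \<in> gen (insert succ_rel (span B_rel))"
    using gen_insert_succ(2)[OF incl(6) dspace_span] mem incl(3) by blast+
  then show "gen (insert succ_rel (span B_rel)) = span lt_rel"
    using gen_insert_succ(1)[OF incl(6) dspace_span] S_notin_span_succ B_notin_span_C by auto
qed

lemma dspace_without_succ:
  assumes V: "dspace V" "A11_rel \<in> V" "V \<subseteq> span lt_rel" "succ_rel \<notin> V"
  shows "V = span A11_rel \<or> V = span S_rel \<or> V = span B_rel"
proof -
  have "refl_inv r" if r: "r \<in> V" for r
  proof -
    obtain N where "invariant lt_eq N r" using lt.span_invariant r V(3) by blast
    then show ?thesis using succ_mem_of_not_refl_inv[OF V(1,2) r] V(4) by blast
  qed
  then have part: "V = {r \<in> gen (insert succ_rel V). refl_inv r}"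
    by (rule eq_refl_inv_part[OF V(1,2)])
  have "A11_rel \<in> span A11_rel" "A11_rel \<in> span S_rel" "A11_rel \<in> span B_rel"
    using in_span[OF wf_rels(3)] span_inclusions by blast+
  then have parts: "span R = {r \<in> gen (insert succ_rel (span R)). refl_inv r}"
    if "R = A11_rel \<or> R = S_rel \<or> R = B_rel" for R
    using that refl_inv_span[of R] refl_inv_betw_rels by (intro eq_refl_inv_part dspace_span) auto
  have "span A11_rel = {r \<in> span succ_rel. refl_inv r}" "span S_rel = {r \<in> span C_rel. refl_inv r}"
    "span B_rel = {r \<in> span lt_rel. refl_inv r}"
    using parts[of A11_rel] parts[of S_rel] parts[of B_rel] gen_insert_succ_span by auto
  then show ?thesis using part gen_insert_succ(1)[OF V(3,1)] by auto
qed

section \<open>The diagram of inclusions\<close>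

lemma hasse_rtrancl:
  "hasse\<^sup>* = Id \<union> {(0,1), (0,2), (0,3), (0,4), (0,5), (1,4), (1,5), (2,3), (2,4), (2,5), (3,5), (4,5)}"
    (is "_ = Id \<union> ?R")
proof
  have closed: "(i, z) \<in> Id \<union> ?R" if "(i, y) \<in> Id \<union> ?R" "(y, z) \<in> hasse" for i y z
    using that unfolding hasse_def by (elim UnE insertE emptyE IdE) simp_all
  show "hasse\<^sup>* \<subseteq> Id \<union> ?R"
  proof (rule subrelI)
    fix i j assume "(i, j) \<in> hasse\<^sup>*"
    then show "(i, j) \<in> Id \<union> ?R"
    proof (induction rule: rtrancl_induct)
      case base
      show ?case by (intro UnI1 IdI)
    next
      case (step y z)
      show ?case by (rule closed[OF step(3,2)])
    qed
  qed
  have h: "(0, 1) \<in> hasse\<^sup>*" "(0, 2) \<in> hasse\<^sup>*" "(2, 3) \<in> hasse\<^sup>*" "(2, 4) \<in> hasse\<^sup>*"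
    "(1, 4) \<in> hasse\<^sup>*" "(3, 5) \<in> hasse\<^sup>*" "(4, 5) \<in> hasse\<^sup>*"
    by (rule r_into_rtrancl, simp add: hasse_def)+
  note h = h rtrancl_trans[OF h(2,3)] rtrancl_trans[OF h(1,5)] rtrancl_trans[OF h(3,6)]
    rtrancl_trans[OF h(5,7)] rtrancl_trans[OF rtrancl_trans[OF h(2,3)] h(6)]
  show "Id \<union> ?R \<subseteq> hasse\<^sup>*"
    by (intro Un_least insert_subsetI empty_subsetI h) auto
qed

lemma all_less_6: "(\<forall>i < (6 :: nat). P i) \<longleftrightarrow> P 0 \<and> P 1 \<and> P 2 \<and> P 3 \<and> P 4 \<and> P 5"
proof -
  have "{..<6 :: nat} = {0, 1, 2, 3, 4, 5}" by auto
  then show ?thesis by (metis (no_types, lifting) insert_iff lessThan_iff singleton_iff)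
qed

theorem mainTheorem1:
  shows
  "(\<forall>V. (dspace V \<and> span A11_rel \<subseteq> V \<and> V \<subseteq> span lt_rel) \<longleftrightarrow> V \<in> set six)
   \<and> distinct six
   \<and> span A11_rel \<subset> span succ_rel \<and> span A11_rel \<subset> span S_rel
   \<and> span S_rel \<subset> span B_rel \<and> span S_rel \<subset> span C_rel
   \<and> span succ_rel \<subset> span C_rel \<and> span B_rel \<subset> span lt_rel
   \<and> span C_rel \<subset> span lt_rel
   \<and> (\<forall>i < 6. \<forall>j < 6. six ! i \<subseteq> six ! j \<longleftrightarrow> (i, j) \<in> hasse\<^sup>*)
   \<and> \<not> span succ_rel \<subseteq> span S_rel \<and> \<not> span S_rel \<subseteq> span succ_rel
   \<and> \<not> span succ_rel \<subseteq> span B_rel \<and> \<not> span B_rel \<subseteq> span succ_rel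
   \<and> \<not> span B_rel \<subseteq> span C_rel \<and> \<not> span C_rel \<subseteq> span B_rel"
proof -
  note incl = span_inclusions
  have le: "span A11_rel \<subseteq> span B_rel" "span A11_rel \<subseteq> span C_rel" "span A11_rel \<subseteq> span lt_rel"
    "span succ_rel \<subseteq> span lt_rel" "span S_rel \<subseteq> span lt_rel"
    using incl by blast+
  \<comment> \<open>Three non-inclusions come from the three invariants (reflection,
    \<open>succ_eq\<close>, \<open>cyc_eq\<close>); all others follow from them through the
    inclusions already known.\<close>
  have n: "\<not> span succ_rel \<subseteq> span B_rel" "\<not> span S_rel \<subseteq> span succ_rel" "\<not> span B_rel \<subseteq> span C_rel"
    using succ_notin_span_B S_notin_span_succ B_notin_span_C in_span wf_rels by blast+
  have nle: "\<not> span succ_rel \<subseteq> span A11_rel" "\<not> span succ_rel \<subseteq> span S_rel"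
    "\<not> span S_rel \<subseteq> span A11_rel" "\<not> span B_rel \<subseteq> span A11_rel" "\<not> span B_rel \<subseteq> span succ_rel"
    "\<not> span B_rel \<subseteq> span S_rel" "\<not> span C_rel \<subseteq> span A11_rel" "\<not> span C_rel \<subseteq> span succ_rel"
    "\<not> span C_rel \<subseteq> span S_rel" "\<not> span C_rel \<subseteq> span B_rel" "\<not> span lt_rel \<subseteq> span A11_rel"
    "\<not> span lt_rel \<subseteq> span succ_rel" "\<not> span lt_rel \<subseteq> span S_rel" "\<not> span lt_rel \<subseteq> span B_rel"
    "\<not> span lt_rel \<subseteq> span C_rel"
    using incl n by (meson subset_trans)+
  have "(dspace V \<and> span A11_rel \<subseteq> V \<and> V \<subseteq> span lt_rel) \<longleftrightarrow> V \<in> set six" for V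
  proof
    assume V: "dspace V \<and> span A11_rel \<subseteq> V \<and> V \<subseteq> span lt_rel"
    then have "A11_rel \<in> V" using in_span[OF wf_rels(3)] by blast
    then show "V \<in> set six"
      using V dspace_with_succ[of V] dspace_without_succ[of V] unfolding six_def by auto
  next
    assume "V \<in> set six"
    then show "dspace V \<and> span A11_rel \<subseteq> V \<and> V \<subseteq> span lt_rel"
      using incl le by (auto simp: six_def dspace_span)
  qed
  moreover have "distinct six"
    using n nle by (auto simp: six_def)
  moreover have "\<forall>i < 6. \<forall>j < 6. six ! i \<subseteq> six ! j \<longleftrightarrow> (i, j) \<in> hasse\<^sup>*"
    unfolding all_less_6 hasse_rtrancl six_def using incl le n nle by simp
  ultimately show ?thesis using incl n nle by blast
qed

end
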